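(* Let $n\in\mathbb{N}$ and let $\mathscr{S}$ be a Hilbert space. The following are equivalent: (i) $\mathscr{S}$ is an interpolation space with respect to the scale $\{H^{(s)}(\mathbb{Z}^n): s\in\mathbb{R}\}$. (ii) Up to norm equivalence, $\mathscr{S}=H^{\varphi}(\mathbb{Z}^n)$ for some function $\varphi\in RO$.
   Context: Notation on $\mathbb{Z}^n$: $|k|=\sqrt{k_1^2+\dots+k_n^2}$ and $\langle k\rangle=(1+|k|^2)^{1/2}$. $\ell^2(\mathbb{Z}^n)$ is the Hilbert space of square summable functions $u\colon\mathbb{Z}^n\to\mathbb{C}$ with inner product $(u,v)=\sum_{k\in\mathbb{Z}^n}u(k)\overline{v(k)}$ and norm $\|\cdot\|$. $\mathcal{S}(\mathbb{Z}^n)$ is the Schwartz space of functions $u\colon\mathbb{Z}^n\to\mathbb{C}$ with $\sup_{k}|k^{\alpha}(\Delta_k^{\beta}u)(k)|<\infty$ for all $\alpha,\beta\in\mathbb{N}_0^n$, where $\Delta_{k_j}u(k)=u(k+e_j)-u(k)$ and $\Delta_k^\beta=\Delta_{k_1}^{\beta_1}\cdots\Delta_{k_n}^{\beta_n}$. $\mathcal{S}'(\mathbb{Z}^n)$ is the space of continuous linear functionals on $\mathcal{S}(\mathbb{Z}^n)$, identified with functions $u\colon\mathbb{Z}^n\to\mathbb{C}$ of at most polynomial growth acting by $v\mapsto\sum_k u(k)v(k)$. $RO$-varying functions: $\varphi\in RO$ means that $\varphi\colon[1,\infty)\to(0,\infty)$ is Borel measurable and there exist $a>1$, $c\geq1$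 with $c^{-1}\leq\varphi(\lambda t)/\varphi(t)\leq c$ for all $t\geq1$, $\lambda\in[1,a]$. Sobolev spaces: for $s\in\mathbb{R}$, $H^{(s)}(\mathbb{Z}^n)=\{u\in\mathcal{S}'(\mathbb{Z}^n):\langle k\rangle^su\in\ell^2(\mathbb{Z}^n)\}$ with norm $\|u\|_{H^{(s)}}=\|\langle k\rangle^su\|$. For $\varphi\in RO$, $H^{\varphi}(\mathbb{Z}^n)=\{u\in\mathcal{S}'(\mathbb{Z}^n):\varphi(\langle k\rangle)u\in\ell^2(\mathbb{Z}^n)\}$ with inner product $(u,v)_{H^{\varphi}(\mathbb{Z}^n)}=\sum_{k\in\mathbb{Z}^n}[\varphi(\langle k\rangle)]^2u(k)\overline{v(k)}$. Interpolation space for a pair: let $[\mathscr{H}_0,\mathscr{H}_1]$ be an ordered pair of separable complex Hilbert spaces with continuous embedding $\mathscr{H}_1\hookrightarrow\mathscr{H}_0$. A Hilbert space $\mathscr{S}$ is an interpolation space with respect to $[\mathscr{H}_0,\mathscr{H}_1]$ if (i) there are continuous embeddings $\mathscr{H}_1\hookrightarrow\mathscr{S}\hookrightarrow\mathscr{H}_0$; and (ii) any linear operator $T$ in $\mathscr{H}_0$ which acts as a bounded linear operator $T\colon\mathscr{H}_0\to\mathscr{H}_0$ and $T\colon\mathscr{H}_1\to\mathscr{H}_1$ also acts as a bounded linear operator $T\colon\mathscr{S}\to\mathscr{S}$. Interpolation space for a scale: let $\{\mathscr{H}_s:s\in\mathbb{R}\}$ be Hilbert spaces with continuous embeddings $\mathscr{H}_{s_1}\hookrightarrow\mathscr{H}_{s_0}$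 for all $s_0<s_1$. A Hilbert space $\mathscr{S}$ is an interpolation space with respect to this scale if there exist $s_0<s_1$ such that $\mathscr{S}$ is an interpolation space with respect to the pair $[\mathscr{H}_{s_0},\mathscr{H}_{s_1}]$. "Up to norm equivalence" means the two spaces coincide as vector spaces and their norms are equivalent. *)

theory Defs
  imports "HOL-Analysis.Analysis"
begin

section \<open>Hilbert spaces with explicit carrier\<close>

text \<open>Interpolation theory compares several Hilbert spaces whose underlying sets are nested, so
  a space carries its own underlying set, operations and inner product.\<close>

record 'a ip_space =
  vecs :: "'a set"
  vzero :: 'a
  vadd :: "'a \<Rightarrow> 'a \<Rightarrow> 'a"
  vscale :: "complex \<Rightarrow> 'a \<Rightarrow> 'a"
  vinner :: "'a \<Rightarrow> 'a \<Rightarrow> complex"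

definition vnorm :: "'a ip_space \<Rightarrow> 'a \<Rightarrow> real" where
  "vnorm H x = sqrt (Re (vinner H x x))"

text \<open>The value outside the carrier only serves the library locale of metric spaces, which asks for
  nonnegativity and symmetry of the distance on the whole type.\<close>

definition vdist :: "'a ip_space \<Rightarrow> 'a \<Rightarrow> 'a \<Rightarrow> real" where
  "vdist H x y =
     (if x \<in> vecs H \<and> y \<in> vecs H then vnorm H (vadd H x (vscale H (-1) y)) else 0)"

definition vtopology :: "'a ip_space \<Rightarrow> 'a topology" where
  "vtopology H = Metric_space.mtopology (vecs H) (vdist H)"

locale complex_hilbert_space =
  fixes H :: "'a ip_space"
  assumes zero_closed: "vzero H \<in> vecs H"
    and add_closed: "x \<in> vecs H \<Longrightarrow> y \<in> vecs H \<Longrightarrow> vadd H x y \<in> vecs H"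
    and scale_closed: "x \<in> vecs H \<Longrightarrow> vscale H a x \<in> vecs H"
    and add_assoc: "x \<in> vecs H \<Longrightarrow> y \<in> vecs H \<Longrightarrow> z \<in> vecs H \<Longrightarrow>
      vadd H (vadd H x y) z = vadd H x (vadd H y z)"
    and add_commute: "x \<in> vecs H \<Longrightarrow> y \<in> vecs H \<Longrightarrow> vadd H x y = vadd H y x"
    and add_zero: "x \<in> vecs H \<Longrightarrow> vadd H x (vzero H) = x"
    and add_neg: "x \<in> vecs H \<Longrightarrow> vadd H x (vscale H (-1) x) = vzero H"
    and scale_add_right: "x \<in> vecs H \<Longrightarrow> y \<in> vecs H \<Longrightarrow>
      vscale H a (vadd H x y) = vadd H (vscale H a x) (vscale H a y)"
    and scale_add_left: "x \<in> vecs H \<Longrightarrow>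
      vscale H (a + b) x = vadd H (vscale H a x) (vscale H b x)"
    and scale_scale: "x \<in> vecs H \<Longrightarrow> vscale H a (vscale H b x) = vscale H (a * b) x"
    and scale_one: "x \<in> vecs H \<Longrightarrow> vscale H 1 x = x"
    and inner_add: "x \<in> vecs H \<Longrightarrow> y \<in> vecs H \<Longrightarrow> z \<in> vecs H \<Longrightarrow>
      vinner H (vadd H x y) z = vinner H x z + vinner H y z"
    and inner_scale: "x \<in> vecs H \<Longrightarrow> y \<in> vecs H \<Longrightarrow>
      vinner H (vscale H a x) y = a * vinner H x y"
    and inner_cnj: "x \<in> vecs H \<Longrightarrow> y \<in> vecs H \<Longrightarrow> vinner H y x = cnj (vinner H x y)"
    and inner_nonneg: "x \<in> vecs H \<Longrightarrow> 0 \<le> Re (vinner H x x)"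
    and inner_definite: "x \<in> vecs H \<Longrightarrow> vinner H x x = 0 \<Longrightarrow> x = vzero H"
    and complete: "Metric_space.mcomplete (vecs H) (vdist H)"


section \<open>Linear operators and embeddings\<close>

definition linear_map :: "'a ip_space \<Rightarrow> 'b ip_space \<Rightarrow> ('a \<Rightarrow> 'b) \<Rightarrow> bool" where
  "linear_map H K T \<longleftrightarrow>
     T ` vecs H \<subseteq> vecs K \<and>
     (\<forall>x\<in>vecs H. \<forall>y\<in>vecs H. T (vadd H x y) = vadd K (T x) (T y)) \<and>
     (\<forall>a. \<forall>x\<in>vecs H. T (vscale H a x) = vscale K a (T x))"

definition bounded_linear_map :: "'a ip_space \<Rightarrow> 'b ip_space \<Rightarrow> ('a \<Rightarrow> 'b) \<Rightarrow> bool" where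
  "bounded_linear_map H K T \<longleftrightarrow>
     linear_map H K T \<and> (\<exists>C. \<forall>x\<in>vecs H. vnorm K (T x) \<le> C * vnorm H x)"

text \<open>Linearity of the identity map says that \<open>vecs H \<subseteq> vecs K\<close> and that the vector space
  operations of \<open>H\<close> are those of \<open>K\<close>.\<close>

definition continuously_embedded :: "'a ip_space \<Rightarrow> 'a ip_space \<Rightarrow> bool" where
  "continuously_embedded H K \<longleftrightarrow>
     linear_map H K (\<lambda>x. x) \<and> continuous_map (vtopology H) (vtopology K) (\<lambda>x. x)"

definition equal_up_to_norm_equivalence :: "'a ip_space \<Rightarrow> 'a ip_space \<Rightarrow> bool" where
  "equal_up_to_norm_equivalence H K \<longleftrightarrow>
     vecs H = vecs K \<and> linear_map H K (\<lambda>x. x) \<and>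
     (\<exists>c C. 0 < c \<and> 0 < C \<and>
        (\<forall>x\<in>vecs H. c * vnorm K x \<le> vnorm H x \<and> vnorm H x \<le> C * vnorm K x))"


section \<open>Interpolation spaces\<close>

definition admissible_pair :: "'a ip_space \<Rightarrow> 'a ip_space \<Rightarrow> bool" where
  "admissible_pair H0 H1 \<longleftrightarrow>
     complex_hilbert_space H0 \<and> separable_space (vtopology H0) \<and>
     complex_hilbert_space H1 \<and> separable_space (vtopology H1) \<and>
     continuously_embedded H1 H0"

definition interpolation_space_pair ::
    "'a ip_space \<Rightarrow> 'a ip_space \<Rightarrow> 'a ip_space \<Rightarrow> bool" where
  "interpolation_space_pair H0 H1 S \<longleftrightarrow>
     admissible_pair H0 H1 \<and> complex_hilbert_space S \<and>
     continuously_embedded H1 S \<and> continuously_embedded S H0 \<and>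
     (\<forall>T. bounded_linear_map H0 H0 T \<longrightarrow> bounded_linear_map H1 H1 T \<longrightarrow>
          bounded_linear_map S S T)"

definition hilbert_scale :: "(real \<Rightarrow> 'a ip_space) \<Rightarrow> bool" where
  "hilbert_scale H \<longleftrightarrow>
     (\<forall>s. complex_hilbert_space (H s)) \<and>
     (\<forall>s0 s1. s0 < s1 \<longrightarrow> continuously_embedded (H s1) (H s0))"

definition interpolation_space_scale :: "(real \<Rightarrow> 'a ip_space) \<Rightarrow> 'a ip_space \<Rightarrow> bool" where
  "interpolation_space_scale H S \<longleftrightarrow>
     hilbert_scale H \<and> (\<exists>s0 s1. s0 < s1 \<and> interpolation_space_pair (H s0) (H s1) S)"


section \<open>Function spaces on the lattice\<close>

definition lattice_norm :: "int ^ 'n \<Rightarrow> real" where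
  "lattice_norm k = sqrt (\<Sum>i\<in>UNIV. (real_of_int (k $ i))\<^sup>2)"

definition bracket :: "int ^ 'n \<Rightarrow> real" where
  "bracket k = sqrt (1 + (lattice_norm k)\<^sup>2)"

definition ell2 :: "(int ^ 'n \<Rightarrow> complex) set" where
  "ell2 = {u. (\<lambda>k. (cmod (u k))\<^sup>2) summable_on UNIV}"

text \<open>The space \<open>S'\<close> of tempered distributions on the lattice, under its identification with the
  functions of at most polynomial growth.\<close>

definition tempered :: "(int ^ 'n \<Rightarrow> complex) set" where
  "tempered = {u. \<exists>C N. \<forall>k. cmod (u k) \<le> C * bracket k ^ N}"

definition weighted_space ::
    "(int ^ 'n \<Rightarrow> real) \<Rightarrow> (int ^ 'n \<Rightarrow> complex) ip_space" where
  "weighted_space w =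
     \<lparr> vecs = {u \<in> tempered. (\<lambda>k. complex_of_real (w k) * u k) \<in> ell2},
       vzero = (\<lambda>k. 0),
       vadd = (\<lambda>u v k. u k + v k),
       vscale = (\<lambda>a u k. a * u k),
       vinner = (\<lambda>u v. \<Sum>\<^sub>\<infinity>k. complex_of_real ((w k)\<^sup>2) * u k * cnj (v k)) \<rparr>"

definition sobolev :: "real \<Rightarrow> (int ^ 'n \<Rightarrow> complex) ip_space" where
  "sobolev s = weighted_space (\<lambda>k. bracket k powr s)"

text \<open>Functions on \<open>[1,\<infinity>)\<close> are represented by functions on the whole real line whose values
  below \<open>1\<close> are irrelevant.\<close>

definition RO :: "(real \<Rightarrow> real) set" where
  "RO = {\<phi>. \<phi> \<in> borel_measurable (restrict_space borel {1..}) \<and>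
            (\<forall>t\<ge>1. 0 < \<phi> t) \<and>
            (\<exists>a c. 1 < a \<and> 1 \<le> c \<and>
               (\<forall>t\<ge>1. \<forall>l\<in>{1..a}. inverse c \<le> \<phi> (l * t) / \<phi> t \<and> \<phi> (l * t) / \<phi> t \<le> c))}"

definition sobolev_RO :: "(real \<Rightarrow> real) \<Rightarrow> (int ^ 'n \<Rightarrow> complex) ip_space" where
  "sobolev_RO \<phi> = weighted_space (\<lambda>k. \<phi> (bracket k))"

end

theory Submission
  imports Defs
begin

text \<open>Every space that occurs here turns out to be a weighted space of square summable functions
  on the lattice, so the two implications are statements about weights.

  \<^bold>\<open>RO-varying weights interpolate.\<close> An RO-varying \<open>\<phi>\<close> changes by at most a power of the ratio of
  its arguments (\<open>RO_growth\<close>).  If \<open>s\<close> exceeds that power, then the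
  square of \<open>\<phi> t\<close> is comparable with a sum over the powers \<open>y\<close> of two of the square of \<open>\<phi> y\<close> times the
  square of \<open>min ((t / y) powr (-s)) ((t / y) powr s)\<close>, because the terms decay geometrically as \<open>y\<close>
  moves away from \<open>t\<close> (\<open>RO_weight_equivalent_dyadic\<close>).  For each \<open>y\<close> this minimum is the minimum of
  multiples of the weights of the Sobolev spaces of orders \<open>-s\<close> and \<open>s\<close>.  An operator bounded for both of
  these weights is bounded for the minimum of any multiples of them, with a constant that does not
  depend on the multiples: split the argument according to which weight is the smaller one
  (\<open>bounded_on_minimum_weight\<close>).  Summing over \<open>y\<close> gives boundedness on the space
  with weight \<open>\<phi>\<close>.  This is the method of
  the K-functional, in the case where the K-functional is explicit.

  \<^bold>\<open>Interpolation spaces are weighted.\<close> Let \<open>S\<close> be an interpolation space and let \<open>w(k)\<close> be the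
  norm in \<open>S\<close> of the point mass at \<open>k\<close>.  Restriction of functions to any set \<open>A\<close> of lattice points
  is bounded on all Sobolev spaces, hence on \<open>S\<close>.  A bound uniform in \<open>A\<close> comes from a category
  argument (\<open>cylinder_category\<close>), which applies because the balls of the Hilbert space \<open>S\<close> are closed
  under pointwise convergence (\<open>ball_pointwise_closed\<close>).  Changes of sign are therefore uniformly
  bounded on \<open>S\<close>.  By the parallelogram law suitable signs make the norm of a finite sum of vectors at
  most, and other signs at least, what it would be if they were orthogonal (\<open>sign_choice\<close>), so the
  norm of \<open>S\<close> is equivalent to the weighted norm given by \<open>w\<close>
  (\<open>norm_equivalent_weighted\<close>).  Finally, moving point masses between lattice points of comparable
  size is bounded on all Sobolev spaces; if \<open>w\<close> were not comparable at such points, then infinitely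
  many disjoint moves would combine to one operator that is unbounded on \<open>S\<close>
  (\<open>delta_norm_comparable\<close>).  So \<open>w(k)\<close> depends, up to a bounded factor, only on the size of \<open>k\<close>, and
  sampling \<open>w\<close> along a coordinate axis gives the RO-varying function.\<close>


section \<open>Inner product spaces with an explicit carrier\<close>

text \<open>The axioms of a complex Hilbert space without completeness.  Completeness refers to a metric,
  and that the distance is one follows from the other axioms; they are split off so that the
  metric is available when completeness of a concrete space is proved.\<close>

locale complex_inner_space =
  fixes H :: "'a ip_space"
  assumes zero_closed: "vzero H \<in> vecs H"
    and add_closed: "x \<in> vecs H \<Longrightarrow> y \<in> vecs H \<Longrightarrow> vadd H x y \<in> vecs H"
    and scale_closed: "x \<in> vecs H \<Longrightarrow> vscale H a x \<in> vecs H"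
    and add_assoc: "x \<in> vecs H \<Longrightarrow> y \<in> vecs H \<Longrightarrow> z \<in> vecs H \<Longrightarrow>
      vadd H (vadd H x y) z = vadd H x (vadd H y z)"
    and add_commute: "x \<in> vecs H \<Longrightarrow> y \<in> vecs H \<Longrightarrow> vadd H x y = vadd H y x"
    and add_zero: "x \<in> vecs H \<Longrightarrow> vadd H x (vzero H) = x"
    and add_neg: "x \<in> vecs H \<Longrightarrow> vadd H x (vscale H (-1) x) = vzero H"
    and scale_add_right: "x \<in> vecs H \<Longrightarrow> y \<in> vecs H \<Longrightarrow>
      vscale H a (vadd H x y) = vadd H (vscale H a x) (vscale H a y)"
    and scale_add_left: "x \<in> vecs H \<Longrightarrow>
      vscale H (a + b) x = vadd H (vscale H a x) (vscale H b x)"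
    and scale_scale: "x \<in> vecs H \<Longrightarrow> vscale H a (vscale H b x) = vscale H (a * b) x"
    and scale_one: "x \<in> vecs H \<Longrightarrow> vscale H 1 x = x"
    and inner_add: "x \<in> vecs H \<Longrightarrow> y \<in> vecs H \<Longrightarrow> z \<in> vecs H \<Longrightarrow>
      vinner H (vadd H x y) z = vinner H x z + vinner H y z"
    and inner_scale: "x \<in> vecs H \<Longrightarrow> y \<in> vecs H \<Longrightarrow>
      vinner H (vscale H a x) y = a * vinner H x y"
    and inner_cnj: "x \<in> vecs H \<Longrightarrow> y \<in> vecs H \<Longrightarrow> vinner H y x = cnj (vinner H x y)"
    and inner_nonneg: "x \<in> vecs H \<Longrightarrow> 0 \<le> Re (vinner H x x)"
    and inner_definite: "x \<in> vecs H \<Longrightarrow> vinner H x x = 0 \<Longrightarrow> x = vzero H"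
begin

lemma norm_nonneg: "x \<in> vecs H \<Longrightarrow> 0 \<le> vnorm H x"
  by (simp add: vnorm_def inner_nonneg)

lemma inner_self:
  assumes "x \<in> vecs H" shows "vinner H x x = of_real ((vnorm H x)\<^sup>2)"
proof (rule complex_eqI)
  show "Re (vinner H x x) = Re (of_real ((vnorm H x)\<^sup>2))"
    using assms by (simp add: vnorm_def inner_nonneg)
  have "Im (vinner H x x) = - Im (vinner H x x)"
    using inner_cnj[OF assms assms] by (metis cnj.sel(2))
  then show "Im (vinner H x x) = Im (of_real ((vnorm H x)\<^sup>2))" by simp
qed

lemma norm_eq_zeroD: "x \<in> vecs H \<Longrightarrow> vnorm H x = 0 \<Longrightarrow> x = vzero H"
  by (rule inner_definite) (auto simp: inner_self)

lemma norm_scale: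
  assumes x: "x \<in> vecs H" shows "vnorm H (vscale H a x) = cmod a * vnorm H x"
proof -
  have "vinner H (vscale H a x) (vscale H a x) = a * vinner H x (vscale H a x)"
    using x by (simp add: inner_scale scale_closed)
  also have "\<dots> = a * cnj a * vinner H x x"
    using x by (subst inner_cnj) (auto simp: inner_scale scale_closed inner_self)
  finally have "vinner H (vscale H a x) (vscale H a x) = of_real ((cmod a * vnorm H x)\<^sup>2)"
    using x by (simp add: inner_self complex_norm_square[unfolded of_real_power] power_mult_distrib)
  then show ?thesis
    using norm_nonneg[OF x] unfolding vnorm_def[of H "vscale H a x"] by simp
qed

lemma zero_scale: "x \<in> vecs H \<Longrightarrow> vscale H 0 x = vzero H"
  using scale_add_left[of x 1 "-1"] by (simp add: scale_one add_neg)

lemma norm_zero: "vnorm H (vzero H) = 0"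
  using norm_scale[OF zero_closed, of 0] by (simp add: zero_scale[OF zero_closed])

text \<open>The polarization identity behind the parallelogram law and the triangle inequality.\<close>

lemma norm_add_square:
  assumes x: "x \<in> vecs H" and y: "y \<in> vecs H"
  shows "(vnorm H (vadd H x y))\<^sup>2 = (vnorm H x)\<^sup>2 + (vnorm H y)\<^sup>2 + 2 * Re (vinner H x y)"
proof -
  have "vinner H (vadd H x y) (vadd H x y) = vinner H x (vadd H x y) + vinner H y (vadd H x y)"
    using x y by (simp add: inner_add add_closed)
  also have "vinner H x (vadd H x y) = cnj (vinner H x x + vinner H y x)"
    using x y by (subst inner_cnj) (auto simp: inner_add add_closed)
  also have "vinner H y (vadd H x y) = cnj (vinner H x y + vinner H y y)"
    using x y by (subst inner_cnj) (auto simp: inner_add add_closed)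
  finally have "Re (vinner H (vadd H x y) (vadd H x y))
      = Re (vinner H x x) + Re (vinner H y x) + Re (vinner H x y) + Re (vinner H y y)"
    by simp
  moreover have "Re (vinner H y x) = Re (vinner H x y)"
    using inner_cnj[OF x y] by simp
  ultimately show ?thesis
    using x y add_closed[OF x y] by (simp add: inner_self)
qed

lemma inner_scale_right_real:
  assumes x: "x \<in> vecs H" and y: "y \<in> vecs H"
  shows "Re (vinner H x (vscale H (of_real t) y)) = t * Re (vinner H x y)"
  using assms by (subst inner_cnj) (auto simp: inner_scale scale_closed inner_cnj[of y x])

lemma parallelogram:
  assumes x: "x \<in> vecs H" and y: "y \<in> vecs H"
  shows "(vnorm H (vadd H x y))\<^sup>2 + (vnorm H (vadd H x (vscale H (-1) y)))\<^sup>2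
       = 2 * ((vnorm H x)\<^sup>2 + (vnorm H y)\<^sup>2)"
  using norm_add_square[OF x y] norm_add_square[OF x scale_closed[OF y, of "-1"]]
    inner_scale_right_real[OF x y, of "-1"] norm_scale[OF y, of "-1"] by simp

lemma Re_inner_le:
  assumes x: "x \<in> vecs H" and y: "y \<in> vecs H"
  shows "Re (vinner H x y) \<le> vnorm H x * vnorm H y"
proof (cases "vnorm H y = 0")
  case True
  then have y0: "y = vscale H 0 y" using y by (simp add: norm_eq_zeroD zero_scale)
  have "Re (vinner H x y) = 0"
    using inner_scale_right_real[OF x y, of 0] y0 by simp
  then show ?thesis using True by simp
next
  case False
  then have ny: "vnorm H y > 0" using norm_nonneg[OF y] by simp
  \<comment> \<open>This real \<open>t\<close> minimizes the squared norm of \<open>x + t y\<close>.\<close>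
  define R t where "R = Re (vinner H x y)" and "t = - R / (vnorm H y)\<^sup>2"
  have "0 \<le> (vnorm H (vadd H x (vscale H (of_real t) y)))\<^sup>2" by simp
  also have "\<dots> = (vnorm H x)\<^sup>2 + (\<bar>t\<bar> * vnorm H y)\<^sup>2 + 2 * (t * R)"
    using norm_add_square[OF x scale_closed[OF y, of "of_real t"]]
      inner_scale_right_real[OF x y, of t] norm_scale[OF y, of "of_real t"]
    by (simp add: R_def)
  also have "\<dots> = (vnorm H x)\<^sup>2 - R\<^sup>2 / (vnorm H y)\<^sup>2"
    using ny by (simp add: t_def power_mult_distrib power2_eq_square divide_simps)
  finally have "R\<^sup>2 \<le> (vnorm H x * vnorm H y)\<^sup>2"
    using ny by (simp add: power_mult_distrib divide_simps)
  then show ?thesis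
    using norm_nonneg[OF x] norm_nonneg[OF y]
    by (metis R_def abs_le_square_iff abs_of_nonneg abs_ge_self mult_nonneg_nonneg order_trans)
qed

lemma norm_triangle:
  assumes x: "x \<in> vecs H" and y: "y \<in> vecs H"
  shows "vnorm H (vadd H x y) \<le> vnorm H x + vnorm H y"
proof (rule power2_le_imp_le)
  show "(vnorm H (vadd H x y))\<^sup>2 \<le> (vnorm H x + vnorm H y)\<^sup>2"
    using Re_inner_le[OF x y] by (simp add: norm_add_square x y power2_sum)
qed (simp add: norm_nonneg x y)

lemma diff_telescope:
  assumes "x \<in> vecs H" "y \<in> vecs H" "z \<in> vecs H"
  shows "vadd H (vadd H x (vscale H (-1) y)) (vadd H y (vscale H (-1) z)) = vadd H x (vscale H (-1) z)"
proof -
  have "vadd H (vscale H (-1) y) (vadd H y (vscale H (-1) z))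
      = vadd H (vadd H (vscale H (-1) y) y) (vscale H (-1) z)"
    using assms by (simp add: add_assoc scale_closed)
  also have "vadd H (vscale H (-1) y) y = vzero H"
    using assms by (simp add: add_commute scale_closed add_neg)
  also have "vadd H (vzero H) (vscale H (-1) z) = vscale H (-1) z"
    using assms add_commute[OF zero_closed scale_closed] by (simp add: scale_closed add_zero)
  finally show ?thesis
    using assms by (simp add: add_assoc scale_closed add_closed)
qed

lemma diff_swap:
  assumes "x \<in> vecs H" "y \<in> vecs H"
  shows "vadd H y (vscale H (-1) x) = vscale H (-1) (vadd H x (vscale H (-1) y))"
  using assms by (simp add: scale_add_right scale_closed scale_scale scale_one add_commute)

sublocale metric: Metric_space "vecs H" "vdist H"
proof
  show "0 \<le> vdist H x y" for x y
    by (simp add: vdist_def norm_nonneg add_closed scale_closed)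
  show "vdist H x y = vdist H y x" for x y
    by (auto simp: vdist_def diff_swap[of x y] norm_scale add_closed scale_closed)
next
  fix x y assume xy: "x \<in> vecs H" "y \<in> vecs H"
  show "vdist H x y = 0 \<longleftrightarrow> x = y"
  proof
    assume "vdist H x y = 0"
    then have 0: "vadd H x (vscale H (-1) y) = vzero H"
      using xy by (intro norm_eq_zeroD) (auto simp: vdist_def add_closed scale_closed)
    have "x = vadd H x (vadd H (vscale H (-1) y) y)"
      using xy by (simp add: add_commute[of _ y] scale_closed add_neg add_zero)
    also have "\<dots> = vadd H (vzero H) y"
      using xy by (simp add: add_assoc[symmetric] scale_closed 0)
    finally show "x = y" using xy by (simp add: add_commute zero_closed add_zero)
  qed (use xy in \<open>simp add: vdist_def add_neg norm_zero\<close>)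
next
  fix x y z assume "x \<in> vecs H" "y \<in> vecs H" "z \<in> vecs H"
  then show "vdist H x z \<le> vdist H x y + vdist H y z"
    using norm_triangle[of "vadd H x (vscale H (-1) y)" "vadd H y (vscale H (-1) z)"]
    by (simp add: vdist_def diff_telescope add_closed scale_closed)
qed

lemma scale_zero: "vscale H a (vzero H) = vzero H"
  using scale_scale[OF zero_closed, of a 0] zero_scale[OF zero_closed] by simp

lemma dist_zero: "x \<in> vecs H \<Longrightarrow> vdist H (vzero H) x = vnorm H x"
  by (subst metric.commute) (simp add: vdist_def zero_closed scale_zero add_zero)

end

sublocale complex_hilbert_space \<subseteq> complex_inner_space
  by unfold_locales
    (fact zero_closed add_closed scale_closed add_assoc add_commute add_zero add_neg scale_add_right
      scale_add_left scale_scale scale_one inner_add inner_scale inner_cnj inner_nonneg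
      inner_definite)+

lemma complex_hilbert_spaceI:
  assumes "complex_inner_space H" and "Metric_space.mcomplete (vecs H) (vdist H)"
  shows "complex_hilbert_space H"
proof -
  interpret complex_inner_space H by fact
  show ?thesis
    by unfold_locales
    (fact zero_closed add_closed scale_closed add_assoc add_commute add_zero add_neg scale_add_right
      scale_add_left scale_scale scale_one inner_add inner_scale inner_cnj inner_nonneg
      inner_definite assms)+
qed

lemma linear_map_zero:
  assumes "complex_inner_space H" "complex_inner_space K" "linear_map H K T"
  shows "T (vzero H) = vzero K"
proof -
  interpret H: complex_inner_space H by fact
  interpret K: complex_inner_space K by fact
  have "T (vscale H 0 (vzero H)) = vscale K 0 (T (vzero H))"
    using assms(3) H.zero_closed by (simp add: linear_map_def)
  moreover have "T (vzero H) \<in> vecs K"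
    using assms(3) H.zero_closed by (auto simp: linear_map_def)
  ultimately show ?thesis
    by (simp add: H.zero_scale H.zero_closed K.zero_scale)
qed

text \<open>Continuity at zero gives a ball that is mapped into the unit ball; rescaling turns this into
  a bound.  Continuous embeddings can thus be handled through norms alone.\<close>

lemma continuous_linear_iff_bounded:
  assumes "complex_inner_space H" "complex_inner_space K" and T: "linear_map H K T"
  shows "continuous_map (vtopology H) (vtopology K) T \<longleftrightarrow>
         (\<exists>C. \<forall>x\<in>vecs H. vnorm K (T x) \<le> C * vnorm H x)"
proof -
  interpret H: complex_inner_space H by fact
  interpret K: complex_inner_space K by fact
  have T_in: "T x \<in> vecs K" if "x \<in> vecs H" for x
    using T that by (auto simp: linear_map_def)
  have T_add: "T (vadd H x y) = vadd K (T x) (T y)" if "x \<in> vecs H" "y \<in> vecs H" for x y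
    using T that by (simp add: linear_map_def)
  have T_scale: "T (vscale H a x) = vscale K a (T x)" if "x \<in> vecs H" for a x
    using T that by (simp add: linear_map_def)
  have cont: "continuous_map (vtopology H) (vtopology K) T \<longleftrightarrow>
    (\<forall>a\<in>vecs H. \<forall>\<epsilon>>0. \<exists>\<delta>>0. \<forall>x. x \<in> vecs H \<and> vdist H a x < \<delta> \<longrightarrow> vdist K (T a) (T x) < \<epsilon>)"
    unfolding vtopology_def H.metric.metric_continuous_map[OF K.metric.Metric_space_axioms]
    using T_in by auto
  show ?thesis
  proof
    assume "continuous_map (vtopology H) (vtopology K) T"
    then obtain d where d: "d > 0"
      and small: "\<And>x. x \<in> vecs H \<Longrightarrow> vdist H (vzero H) x < d \<Longrightarrow> vdist K (T (vzero H)) (T x) < 1"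
      unfolding cont using H.zero_closed zero_less_one by metis
    have small: "vnorm K (T x) < 1" if "x \<in> vecs H" "vnorm H x < d" for x
      using small[of x] that
      by (simp add: H.dist_zero linear_map_zero[OF assms] K.dist_zero T_in)
    have "vnorm K (T x) \<le> (2 / d) * vnorm H x" if x: "x \<in> vecs H" for x
    proof (cases "vnorm H x = 0")
      case True
      then have "T x = vzero K" 
        using H.norm_eq_zeroD[OF x] linear_map_zero[OF assms] by simp
      then show ?thesis using True by (simp add: K.norm_zero)
    next
      case False
      then have n: "vnorm H x > 0" using H.norm_nonneg[OF x] by simp
      define t where "t = d / (2 * vnorm H x)"
      have t: "t > 0" using n d by (simp add: t_def)
      have "vnorm K (T (vscale H (of_real t) x)) < 1"
        using x n d t by (intro small) (auto simp: H.scale_closed H.norm_scale, simp add: t_def)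
      then have "t * vnorm K (T x) < 1"
        using x t by (simp add: T_scale K.norm_scale T_in)
      then show ?thesis using n d by (simp add: t_def field_simps)
    qed
    then show "\<exists>C. \<forall>x\<in>vecs H. vnorm K (T x) \<le> C * vnorm H x" by blast
  next
    assume "\<exists>C. \<forall>x\<in>vecs H. vnorm K (T x) \<le> C * vnorm H x"
    then obtain C where C: "\<And>x. x \<in> vecs H \<Longrightarrow> vnorm K (T x) \<le> C * vnorm H x" by blast
    define D where "D = \<bar>C\<bar> + 1"
    have D: "vnorm K (T x) \<le> D * vnorm H x" if "x \<in> vecs H" for x
      unfolding D_def using C[OF that] H.norm_nonneg[OF that]
      by (meson abs_ge_self add_increasing2 mult_right_mono order_trans zero_le_one)
    have dist: "vdist K (T a) (T x) \<le> D * vdist H a x" if "a \<in> vecs H" "x \<in> vecs H" for a x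
    proof -
      have "vadd K (T a) (vscale K (-1) (T x)) = T (vadd H a (vscale H (-1) x))"
        using that by (simp add: T_add T_scale H.scale_closed)
      then show ?thesis
        using that D[of "vadd H a (vscale H (-1) x)"]
        by (simp add: vdist_def T_in H.add_closed H.scale_closed)
    qed
    show "continuous_map (vtopology H) (vtopology K) T"
      unfolding cont
    proof (intro ballI allI impI)
      fix a \<epsilon> assume a: "a \<in> vecs H" and e: "(0::real) < \<epsilon>"
      have Dp: "D > 0" by (simp add: D_def)
      have "vdist K (T a) (T x) < \<epsilon>" if "x \<in> vecs H" "vdist H a x < \<epsilon> / D" for x
        using dist[OF a that(1)] that(2) Dp by (simp add: field_simps)
      moreover have "\<epsilon> / D > 0" using e Dp by simp
      ultimately show "\<exists>\<delta>>0. \<forall>x. x \<in> vecs H \<and> vdist H a x < \<delta> \<longrightarrow> vdist K (T a) (T x) < \<epsilon>"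
        by blast
    qed
  qed
qed

lemma continuously_embedded_iff:
  assumes "complex_inner_space H" "complex_inner_space K"
  shows "continuously_embedded H K \<longleftrightarrow> bounded_linear_map H K (\<lambda>x. x)"
  using continuous_linear_iff_bounded[OF assms, of "\<lambda>x. x"]
  by (auto simp: continuously_embedded_def bounded_linear_map_def)


section \<open>Weighted spaces of square summable functions\<close>

lemma bracket_ge_1: "1 \<le> bracket k"
  by (simp add: bracket_def)

lemma bracket_pos: "0 < bracket k"
  using bracket_ge_1[of k] by simp

lemma coordinate_le_bracket: "\<bar>real_of_int (k $ i)\<bar> \<le> bracket k"
proof -
  have "(real_of_int (k $ i))\<^sup>2 \<le> (\<Sum>i\<in>UNIV. (real_of_int (k $ i))\<^sup>2)"
    by (rule member_le_sum) auto
  also have "\<dots> \<le> (bracket k)\<^sup>2"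
    by (simp add: bracket_def lattice_norm_def sum_nonneg)
  finally show ?thesis
    using bracket_pos[of k] by (simp add: abs_le_square_iff[symmetric])
qed

text \<open>Each coordinate is bounded by the size of the point, which leaves finitely many integers for it.\<close>

lemma finite_bracket_ball: "finite {k :: int ^ 'n. bracket k \<le> r}"
proof (rule finite_imageD)
  have "vec_nth ` {k :: int ^ 'n. bracket k \<le> r} \<subseteq> (UNIV :: 'n set) \<rightarrow>\<^sub>E {- \<lfloor>r\<rfloor>..\<lfloor>r\<rfloor>}"
  proof (clarsimp simp: PiE_def Pi_def)
    fix k :: "int ^ 'n" and i assume "bracket k \<le> r"
    then have "\<bar>real_of_int (k $ i)\<bar> \<le> r"
      using coordinate_le_bracket[of k i] by simp
    then show "- \<lfloor>r\<rfloor> \<le> k $ i \<and> k $ i \<le> \<lfloor>r\<rfloor>"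
      by (simp add: le_floor_iff abs_le_iff) linarith
  qed
  then show "finite (vec_nth ` {k :: int ^ 'n. bracket k \<le> r})"
    by (rule finite_subset) (simp add: finite_PiE)
qed (simp add: inj_on_def vec_eq_iff)

text \<open>Convergence is recorded separately because the infinite sum has the value zero when it diverges.\<close>

definition finite_energy :: "('k \<Rightarrow> real) \<Rightarrow> ('k \<Rightarrow> complex) \<Rightarrow> bool" where
  "finite_energy w u \<longleftrightarrow> (\<lambda>k. (w k * cmod (u k))\<^sup>2) summable_on UNIV"

definition energy :: "('k \<Rightarrow> real) \<Rightarrow> ('k \<Rightarrow> complex) \<Rightarrow> real" where
  "energy w u = (\<Sum>\<^sub>\<infinity>k. (w k * cmod (u k))\<^sup>2)"

lemma energy_nonneg: "0 \<le> energy w u"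
  by (simp add: energy_def infsum_nonneg)

lemma sum_le_energy:
  "finite_energy w u \<Longrightarrow> finite F \<Longrightarrow> (\<Sum>k\<in>F. (w k * cmod (u k))\<^sup>2) \<le> energy w u"
  unfolding energy_def finite_energy_def by (rule finite_sum_le_infsum) auto

text \<open>Partial sums of a nonnegative family decide both convergence and the size of the limit, so all
  estimates below are made for finite sums.\<close>

lemma finite_energyI:
  assumes "\<And>F. finite F \<Longrightarrow> (\<Sum>k\<in>F. (w k * cmod (u k))\<^sup>2) \<le> C"
  shows "finite_energy w u" and "energy w u \<le> C"
proof -
  show f: "finite_energy w u"
    unfolding finite_energy_def
    by (rule nonneg_bdd_above_summable_on) (use assms in \<open>auto simp: bdd_above_def\<close>)
  show "energy w u \<le> C"
    unfolding energy_def
    by (rule infsum_le_finite_sums) (use assms f in \<open>auto simp: finite_energy_def\<close>)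
qed

lemma finite_energy_finite_support:
  assumes "finite F" and "\<And>k. k \<notin> F \<Longrightarrow> u k = 0"
  shows "finite_energy w u" and "energy w u = (\<Sum>k\<in>F. (w k * cmod (u k))\<^sup>2)"
proof -
  have "((\<lambda>k. (w k * cmod (u k))\<^sup>2) has_sum (\<Sum>k\<in>F. (w k * cmod (u k))\<^sup>2)) UNIV"
    using assms by (intro has_sum_finite_neutralI[of F]) auto
  then show "finite_energy w u" "energy w u = (\<Sum>k\<in>F. (w k * cmod (u k))\<^sup>2)"
    by (auto simp: finite_energy_def energy_def has_sum_iff)
qed

text \<open>The domination is between weighted values and not between weights, so that it covers comparison
  of two weights, truncation, and multiplication by bounded factors.\<close>

lemma energy_dominated:
  assumes u: "finite_energy w u" and "C \<ge> 0"
    and dom: "\<And>k. \<bar>w' k * cmod (u' k)\<bar> \<le> C * \<bar>w k * cmod (u k)\<bar>"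
  shows "finite_energy w' u'" and "energy w' u' \<le> C\<^sup>2 * energy w u"
proof -
  have "(\<Sum>k\<in>F. (w' k * cmod (u' k))\<^sup>2) \<le> C\<^sup>2 * energy w u" if "finite F" for F
  proof -
    have "(w' k * cmod (u' k))\<^sup>2 \<le> C\<^sup>2 * (w k * cmod (u k))\<^sup>2" for k
      using power_mono[OF dom[of k], of 2] by (simp add: power_mult_distrib)
    then have "(\<Sum>k\<in>F. (w' k * cmod (u' k))\<^sup>2) \<le> C\<^sup>2 * (\<Sum>k\<in>F. (w k * cmod (u k))\<^sup>2)"
      by (simp add: sum_distrib_left sum_mono)
    also have "\<dots> \<le> C\<^sup>2 * energy w u"
      by (intro mult_left_mono sum_le_energy u that) auto
    finally show ?thesis .
  qed
  then show "finite_energy w' u'" "energy w' u' \<le> C\<^sup>2 * energy w u"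
    by (auto intro: finite_energyI)
qed

lemma energy_add:
  assumes u: "finite_energy w u" and v: "finite_energy w v"
  shows "finite_energy w (\<lambda>k. u k + v k)"
    and "energy w (\<lambda>k. u k + v k) \<le> 2 * energy w u + 2 * energy w v"
proof -
  have "(\<Sum>k\<in>F. (w k * cmod (u k + v k))\<^sup>2) \<le> 2 * energy w u + 2 * energy w v" if "finite F" for F
  proof -
    have "(w k * cmod (u k + v k))\<^sup>2 \<le> 2 * (w k * cmod (u k))\<^sup>2 + 2 * (w k * cmod (v k))\<^sup>2" for k
    proof -
      have "(cmod (u k + v k))\<^sup>2 \<le> (cmod (u k) + cmod (v k))\<^sup>2"
        by (intro power_mono norm_triangle_ineq) auto
      also have "\<dots> \<le> 2 * (cmod (u k))\<^sup>2 + 2 * (cmod (v k))\<^sup>2"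
        using sum_squares_bound[of "cmod (u k)" "cmod (v k)"] by (simp add: power2_sum)
      finally have "(w k)\<^sup>2 * (cmod (u k + v k))\<^sup>2
          \<le> (w k)\<^sup>2 * (2 * (cmod (u k))\<^sup>2 + 2 * (cmod (v k))\<^sup>2)"
        by (intro mult_left_mono) auto
      then show ?thesis by (simp add: power_mult_distrib algebra_simps)
    qed
    then have "(\<Sum>k\<in>F. (w k * cmod (u k + v k))\<^sup>2)
        \<le> 2 * (\<Sum>k\<in>F. (w k * cmod (u k))\<^sup>2) + 2 * (\<Sum>k\<in>F. (w k * cmod (v k))\<^sup>2)"
      by (simp add: sum_distrib_left sum.distrib[symmetric] sum_mono)
    then show ?thesis
      using sum_le_energy[OF u that] sum_le_energy[OF v that] by simp
  qed
  then show "finite_energy w (\<lambda>k. u k + v k)"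
    and "energy w (\<lambda>k. u k + v k) \<le> 2 * energy w u + 2 * energy w v"
    by (auto intro: finite_energyI)
qed

lemma energy_scale:
  assumes u: "finite_energy w u"
  shows "finite_energy w (\<lambda>k. a * u k)"
  by (rule energy_dominated[OF u, of "cmod a"]) (auto simp: norm_mult abs_mult)

lemma finite_energy_diff:
  assumes "finite_energy w u" and "finite_energy w v"
  shows "finite_energy w (\<lambda>k. u k - v k)"
  using energy_add(1)[OF assms(1) energy_scale[OF assms(2), of "-1"]] by simp

lemma energy_tail:
  assumes u: "finite_energy w u" and "e > 0"
  obtains F where "finite F" and "\<And>G. F \<subseteq> G \<Longrightarrow> energy w (\<lambda>k. if k \<in> G then 0 else u k) < e"
proof -
  define f where "f = (\<lambda>k. (w k * cmod (u k))\<^sup>2)"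
  have f: "f summable_on UNIV" using u by (simp add: f_def finite_energy_def)
  obtain F where F: "finite F" "dist (sum f F) (energy w u) \<le> e / 2"
    using infsum_finite_approximation[OF f, of "e / 2"] \<open>e > 0\<close> 
    by (auto simp: energy_def f_def)
  have "energy w (\<lambda>k. if k \<in> G then 0 else u k) \<le> e / 2" if G: "F \<subseteq> G" for G
  proof (rule finite_energyI(2))
    fix E :: "'a set" assume E: "finite E"
    have "(\<Sum>k\<in>E. (w k * cmod (if k \<in> G then 0 else u k))\<^sup>2) = sum f (E - G)"
      using E by (simp add: f_def sum.mono_neutral_cong_right[of E "E - G"] if_distrib cong: if_cong)
    also have "\<dots> \<le> sum f (E - F)"
      using G E by (intro sum_mono2) (auto simp: f_def)
    also have "\<dots> = sum f (E \<union> F) - sum f F"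
      using E F(1) sum.union_disjoint[of "E - F" F f] by (simp add: Un_Diff_cancel2 Diff_Int_distrib2)
    also have "\<dots> \<le> energy w u - sum f F"
      using sum_le_energy[OF u, of "E \<union> F"] E F(1) by (simp add: f_def)
    also have "\<dots> \<le> e / 2" using F(2) unfolding dist_real_def by linarith
    finally show "(\<Sum>k\<in>E. (w k * cmod (if k \<in> G then 0 else u k))\<^sup>2) \<le> e / 2" .
  qed
  note tail = this
  show ?thesis
  proof (rule that[OF F(1)])
    fix G assume "F \<subseteq> G"
    from tail[OF this] \<open>e > 0\<close> show "energy w (\<lambda>k. if k \<in> G then 0 else u k) < e" by simp
  qed
qed

text \<open>The lower bound makes every function of finite energy polynomially bounded, so that the condition
  of temperedness in the carrier of the weighted space is automatic.\<close>

definition admissible_weight :: "(int ^ 'n \<Rightarrow> real) \<Rightarrow> bool" where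
  "admissible_weight w \<longleftrightarrow>
     (\<forall>k. 0 < w k) \<and> (\<exists>c>0. \<exists>s. \<forall>k. c * bracket k powr s \<le> w k)"

lemma ell2_iff_finite_energy: "(\<lambda>k. complex_of_real (w k) * u k) \<in> ell2 \<longleftrightarrow> finite_energy w u"
  by (simp add: ell2_def finite_energy_def norm_mult power_mult_distrib)

lemma finite_energy_tempered:
  assumes w: "admissible_weight w" and u: "finite_energy w u"
  shows "u \<in> tempered"
proof -
  obtain c s where c: "c > 0" and cw: "\<And>k. c * bracket k powr s \<le> w k" 
    using w by (auto simp: admissible_weight_def)
  define N where "N = nat \<lceil>\<bar>s\<bar>\<rceil>"
  have "cmod (u k) \<le> (sqrt (energy w u) / c) * bracket k ^ N" for k
  proof -
    have "(w k * cmod (u k))\<^sup>2 \<le> energy w u"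
      using sum_le_energy[OF u, of "{k}"] by simp
    then have 1: "w k * cmod (u k) \<le> sqrt (energy w u)"
      by (rule real_le_rsqrt)
    have "c * bracket k powr s * cmod (u k) \<le> w k * cmod (u k)"
      by (intro mult_right_mono cw) auto
    with 1 have "bracket k powr s * cmod (u k) \<le> sqrt (energy w u) / c"
      using c by (simp add: field_simps)
    then have "bracket k powr (-s) * (bracket k powr s * cmod (u k))
        \<le> bracket k powr (-s) * (sqrt (energy w u) / c)"
      by (intro mult_left_mono) auto
    then have "cmod (u k) \<le> bracket k powr (-s) * (sqrt (energy w u) / c)"
      using bracket_pos[of k] by (simp add: mult.assoc[symmetric] powr_add[symmetric])
    also have "\<dots> \<le> bracket k powr (real N) * (sqrt (energy w u) / c)"
      using bracket_ge_1[of k] c energy_nonneg[of w u]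
      by (intro mult_right_mono powr_mono) (auto simp: N_def, linarith)
    finally show ?thesis
      using bracket_pos[of k] by (simp add: powr_realpow mult.commute)
  qed
  then show ?thesis unfolding tempered_def by blast
qed

lemma vecs_weighted: "admissible_weight w \<Longrightarrow> vecs (weighted_space w) = {u. finite_energy w u}"
  by (auto simp: weighted_space_def ell2_iff_finite_energy finite_energy_tempered)

lemma weighted_ops:
  "vzero (weighted_space w) = (\<lambda>k. 0)"
  "vadd (weighted_space w) u v = (\<lambda>k. u k + v k)"
  "vscale (weighted_space w) a u = (\<lambda>k. a * u k)"
  by (simp_all add: weighted_space_def)

lemma weighted_inner_self: "vinner (weighted_space w) u u = of_real (energy w u)"
proof -
  have "(\<lambda>k. complex_of_real ((w k)\<^sup>2) * u k * cnj (u k))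
      = (\<lambda>k. of_real ((w k * cmod (u k))\<^sup>2))"
    by (rule ext) (simp add: complex_norm_square[unfolded of_real_power] power_mult_distrib)
  then have *: "vinner (weighted_space w) u u = (\<Sum>\<^sub>\<infinity>k. of_real ((w k * cmod (u k))\<^sup>2))"
    by (simp only: weighted_space_def ip_space.simps)
  show ?thesis
  proof (cases "finite_energy w u")
    case True
    then have "((\<lambda>k. (w k * cmod (u k))\<^sup>2) has_sum energy w u) UNIV"
      by (simp add: finite_energy_def energy_def)
    from has_sum_of_real[OF this] show ?thesis
      unfolding * by (rule infsumI)
  next
    case False
    have "\<not> (\<lambda>k. complex_of_real ((w k * cmod (u k))\<^sup>2)) summable_on UNIV"
    proof
      assume "(\<lambda>k. complex_of_real ((w k * cmod (u k))\<^sup>2)) summable_on UNIV"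
      from summable_on_Re[OF this] False show False by (simp add: finite_energy_def)
    qed
    then show ?thesis
      using False unfolding * energy_def finite_energy_def by (simp only: infsum_not_exists of_real_0 not_False_eq_True)
  qed
qed

lemma vnorm_weighted: "vnorm (weighted_space w) u = sqrt (energy w u)"
  by (simp add: vnorm_def weighted_inner_self)

lemma weighted_inner_summable:
  assumes u: "finite_energy w u" and v: "finite_energy w v"
  shows "(\<lambda>k. complex_of_real ((w k)\<^sup>2) * u k * cnj (v k)) summable_on UNIV"
proof -
  have "(\<lambda>k. (w k * cmod (u k))\<^sup>2 + (w k * cmod (v k))\<^sup>2) summable_on UNIV"
    using u v by (auto simp: finite_energy_def intro: summable_on_add)
  moreover have "cmod (complex_of_real ((w k)\<^sup>2) * u k * cnj (v k))
      \<le> (w k * cmod (u k))\<^sup>2 + (w k * cmod (v k))\<^sup>2" for k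
  proof -
    have "cmod (complex_of_real ((w k)\<^sup>2) * u k * cnj (v k)) = (w k * cmod (u k)) * (w k * cmod (v k))"
      by (simp add: norm_mult norm_power power2_eq_square)
    also have "\<dots> \<le> (w k * cmod (u k))\<^sup>2 + (w k * cmod (v k))\<^sup>2"
      using sum_squares_bound[of "w k * cmod (u k)" "w k * cmod (v k)"]
        zero_le_power2[of "w k * cmod (u k)"] zero_le_power2[of "w k * cmod (v k)"] by linarith
    finally show ?thesis .
  qed
  ultimately show ?thesis
    by (rule abs_summable_summable[OF Infinite_Sum.abs_summable_on_comparison_test'])
qed

lemma complex_inner_space_weighted:
  assumes w: "admissible_weight w"
  shows "complex_inner_space (weighted_space w)"
proof
  show "vzero (weighted_space w) \<in> vecs (weighted_space w)"
    by (simp add: vecs_weighted[OF w] weighted_ops finite_energy_def)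
next
  fix u v :: "int ^ 'a \<Rightarrow> complex" and a
  assume u: "u \<in> vecs (weighted_space w)"
  show "vscale (weighted_space w) a u \<in> vecs (weighted_space w)"
    using u by (simp add: vecs_weighted[OF w] weighted_ops energy_scale)
  show "0 \<le> Re (vinner (weighted_space w) u u)"
    by (simp add: weighted_inner_self energy_nonneg)
  show "u = vzero (weighted_space w)" if 0: "vinner (weighted_space w) u u = 0"
  proof -
    have "(w k * cmod (u k))\<^sup>2 = 0" for k
      using sum_le_energy[of w u "{k}"] u 0 zero_le_power2[of "w k * cmod (u k)"]
      by (simp add: weighted_inner_self vecs_weighted[OF w])
    moreover have "w k \<noteq> 0" for k
      using w by (auto simp: admissible_weight_def dest: spec[of _ k])
    ultimately show ?thesis by (auto simp: weighted_ops)
  qed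
  assume v: "v \<in> vecs (weighted_space w)"
  show "vadd (weighted_space w) u v \<in> vecs (weighted_space w)"
    using u v by (simp add: vecs_weighted[OF w] weighted_ops energy_add)
  show "vinner (weighted_space w) (vscale (weighted_space w) a u) v
      = a * vinner (weighted_space w) u v"
    by (simp add: weighted_space_def mult.assoc mult.left_commute[of _ a] infsum_cmult_right')
  show "vinner (weighted_space w) v u = cnj (vinner (weighted_space w) u v)"
    by (simp add: weighted_space_def infsum_cnj[symmetric] mult_ac del: infsum_cnj)
next
  fix u v x :: "int ^ 'a \<Rightarrow> complex"
  assume "u \<in> vecs (weighted_space w)" "v \<in> vecs (weighted_space w)" "x \<in> vecs (weighted_space w)"
  then have "finite_energy w u" "finite_energy w v" "finite_energy w x"
    by (auto simp: vecs_weighted[OF w])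
  from infsum_add[OF weighted_inner_summable[OF this(1,3)] weighted_inner_summable[OF this(2,3)]]
  show "vinner (weighted_space w) (vadd (weighted_space w) u v) x
      = vinner (weighted_space w) u x + vinner (weighted_space w) v x"
    by (simp add: weighted_space_def algebra_simps)
qed (simp_all add: weighted_ops algebra_simps)

lemma vdist_weighted:
  "u \<in> vecs (weighted_space w) \<Longrightarrow> v \<in> vecs (weighted_space w) \<Longrightarrow>
   vdist (weighted_space w) u v = sqrt (energy w (\<lambda>k. u k - v k))"
  by (simp add: vdist_def vnorm_weighted weighted_ops)

text \<open>A Cauchy sequence converges pointwise, since each weight is positive; a finite sum of the energy
  of the difference passes to the pointwise limit and keeps its bound.\<close>

lemma complex_hilbert_space_weighted:
  assumes w: "admissible_weight w"
  shows "complex_hilbert_space (weighted_space w)"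
proof (rule complex_hilbert_spaceI)
  show inner: "complex_inner_space (weighted_space w)"
    by (rule complex_inner_space_weighted[OF w])
  then interpret W: complex_inner_space "weighted_space w" .
  have wpos: "w k > 0" for k using w by (auto simp: admissible_weight_def)
  show "Metric_space.mcomplete (vecs (weighted_space w)) (vdist (weighted_space w))"
    unfolding W.metric.mcomplete_def
  proof (intro allI impI)
    fix u :: "nat \<Rightarrow> int ^ 'a \<Rightarrow> complex"
    assume Cau: "W.metric.MCauchy u"
    then have u_in: "u n \<in> vecs (weighted_space w)" for n
      by (auto simp: W.metric.MCauchy_def)
    then have fin: "finite_energy w (u n)" for n by (simp add: vecs_weighted[OF w])
    have Cauchy_energy: "\<exists>N. \<forall>m\<ge>N. \<forall>n\<ge>N. energy w (\<lambda>k. u m k - u n k) < e\<^sup>2" if "e > 0" for e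
    proof -
      have "\<forall>e>0. \<exists>N. \<forall>m n. N \<le> m \<longrightarrow> N \<le> n \<longrightarrow> vdist (weighted_space w) (u m) (u n) < e"
        using Cau unfolding W.metric.MCauchy_def by (rule conjunct2)
      then obtain N where N: "vdist (weighted_space w) (u m) (u n) < e" if "N \<le> m" "N \<le> n" for m n
        using \<open>e > 0\<close> by meson
      have "energy w (\<lambda>k. u m k - u n k) < e\<^sup>2" if "m \<ge> N" "n \<ge> N" for m n
      proof -
        have "sqrt (energy w (\<lambda>k. u m k - u n k)) < e"
          using N[OF that] vdist_weighted[OF u_in u_in] by metis
        then have "(sqrt (energy w (\<lambda>k. u m k - u n k)))\<^sup>2 < e\<^sup>2"
          by (intro power_strict_mono) (auto simp: energy_nonneg)
        then show ?thesis by (simp only: real_sqrt_pow2[OF energy_nonneg])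
      qed
      then show ?thesis by blast
    qed
    have "Cauchy (\<lambda>n. u n k)" for k
    proof (rule CauchyI)
      fix e :: real assume e: "e > 0"
      then obtain N where N: "\<forall>m\<ge>N. \<forall>n\<ge>N. energy w (\<lambda>k. u m k - u n k) < (w k * e)\<^sup>2"
        using Cauchy_energy[of "w k * e"] wpos[of k] by auto
      have "cmod (u m k - u n k) < e" if "m \<ge> N" "n \<ge> N" for m n
      proof -
        have "(w k * cmod (u m k - u n k))\<^sup>2 \<le> energy w (\<lambda>k. u m k - u n k)"
          using sum_le_energy[OF finite_energy_diff[OF fin[of m] fin[of n]], of "{k}"] by simp
        also have "\<dots> < (w k * e)\<^sup>2" using N that by blast
        finally have "w k * cmod (u m k - u n k) < w k * e"
          using wpos[of k] e by (intro power2_less_imp_less[of _ "w k * e"]) auto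
        then show ?thesis using wpos[of k] by simp
      qed
      then show "\<exists>M. \<forall>m\<ge>M. \<forall>n\<ge>M. norm (u m k - u n k) < e" by blast
    qed
    then have "\<exists>x. (\<lambda>n. u n k) \<longlonglongrightarrow> x" for k
      by (simp add: Cauchy_convergent_iff convergent_def)
    then obtain v where v: "\<And>k. (\<lambda>n. u n k) \<longlonglongrightarrow> v k" by metis
    have close: "\<exists>N. \<forall>m\<ge>N. finite_energy w (\<lambda>k. u m k - v k) \<and> energy w (\<lambda>k. u m k - v k) \<le> e\<^sup>2"
      if "e > 0" for e
    proof -
      obtain N where N: "\<And>m n. m \<ge> N \<Longrightarrow> n \<ge> N \<Longrightarrow> energy w (\<lambda>k. u m k - u n k) < e\<^sup>2"
        using Cauchy_energy[OF \<open>e > 0\<close>] by blast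
      have "(\<Sum>k\<in>F. (w k * cmod (u m k - v k))\<^sup>2) \<le> e\<^sup>2" if m: "m \<ge> N" and F: "finite F" for m F
      proof (rule tendsto_upperbound)
        show "(\<lambda>n. \<Sum>k\<in>F. (w k * cmod (u m k - u n k))\<^sup>2)
            \<longlonglongrightarrow> (\<Sum>k\<in>F. (w k * cmod (u m k - v k))\<^sup>2)"
          by (intro tendsto_intros v)
        have "(\<Sum>k\<in>F. (w k * cmod (u m k - u n k))\<^sup>2) \<le> e\<^sup>2" if n: "n \<ge> N" for n
          using sum_le_energy[OF finite_energy_diff[OF fin[of m] fin[of n]] F] N[OF m n] by simp
        then show "\<forall>\<^sub>F n in sequentially. (\<Sum>k\<in>F. (w k * cmod (u m k - u n k))\<^sup>2) \<le> e\<^sup>2"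
          by (auto simp: eventually_sequentially)
      qed simp
      then show ?thesis
        by (intro exI[of _ N]) (auto intro: finite_energyI)
    qed
    obtain N where "finite_energy w (\<lambda>k. u N k - v k)"
      using close[of 1] by auto
    from finite_energy_diff[OF fin[of N] this] have v_in: "v \<in> vecs (weighted_space w)"
      by (simp add: vecs_weighted[OF w])
    have "limitin W.metric.mtopology u v sequentially"
      unfolding W.metric.limitin_metric
    proof (intro conjI allI impI v_in)
      fix e :: real assume e: "e > 0"
      obtain N where N: "\<And>m. m \<ge> N \<Longrightarrow> energy w (\<lambda>k. u m k - v k) \<le> (e/2)\<^sup>2"
        using close[of "e/2"] e by auto
      have "vdist (weighted_space w) (u m) v < e" if "m \<ge> N" for m
      proof -
        have "sqrt (energy w (\<lambda>k. u m k - v k)) \<le> sqrt ((e/2)\<^sup>2)"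
          by (intro real_sqrt_le_mono N that)
        then show ?thesis using e by (simp add: vdist_weighted u_in v_in)
      qed
      then show "\<forall>\<^sub>F m in sequentially. u m \<in> vecs (weighted_space w) \<and> vdist (weighted_space w) (u m) v < e"
        using u_in by (auto simp: eventually_sequentially)
    qed
    then show "\<exists>x. limitin W.metric.mtopology u x sequentially" by blast
  qed
qed

text \<open>Finitely supported functions with values in a countable dense set of complex numbers are dense:
  cut off a tail of small energy and then approximate the finitely many remaining values.\<close>

lemma separable_weighted:
  fixes w :: "int ^ 'n \<Rightarrow> real"
  assumes w: "admissible_weight w"
  shows "separable_space (vtopology (weighted_space w))"
proof -
  interpret W: complex_inner_space "weighted_space w"
    by (rule complex_inner_space_weighted[OF w])
  obtain D :: "complex set" where D: "countable D" "\<And>X. open X \<Longrightarrow> X \<noteq> {} \<Longrightarrow> \<exists>d\<in>D. d \<in> X"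
    using countable_dense_exists by blast
  define E where "E F = (\<lambda>g k. if k \<in> F then g k else 0) ` (F \<rightarrow>\<^sub>E D)" for F :: "(int ^ 'n) set"
  define B where "B = (\<Union>F\<in>{F. finite F}. E F)"
  have "countable {F :: (int ^ 'n) set. finite F}"
    by (rule countable_Collect_finite)
  then have B: "countable B"
    unfolding B_def E_def by (intro countable_UN countable_image countable_PiE) (use D in auto)
  have B_fin: "finite_energy w b" if "b \<in> B" for b
    using that by (auto simp: B_def E_def intro: finite_energy_finite_support)
  have dense: "\<exists>b\<in>B. energy w (\<lambda>k. u k - b k) < e" if u: "finite_energy w u" and e: "e > 0" for u e
  proof -
    have "e / 4 > 0" using e by simp
    then obtain F where F: "finite F" "\<And>G. F \<subseteq> G \<Longrightarrow> energy w (\<lambda>k. if k \<in> G then 0 else u k) < e / 4"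
      using energy_tail[OF u] by blast
    define r where "r = e / (4 * (real (card F) + 1))"
    have r: "r > 0" using e by (simp add: r_def)
    have "\<exists>d\<in>D. (w k * cmod (u k - d))\<^sup>2 < r" for k
    proof -
      have "open {d. (w k * cmod (u k - d))\<^sup>2 < r}"
        by (intro open_Collect_less continuous_intros)
      moreover have "u k \<in> {d. (w k * cmod (u k - d))\<^sup>2 < r}" using r by simp
      ultimately show ?thesis using D(2) by blast
    qed
    then obtain d where d: "\<And>k. d k \<in> D" "\<And>k. (w k * cmod (u k - d k))\<^sup>2 < r" by metis
    define b where "b = (\<lambda>k. if k \<in> F then d k else 0)"
    have "b \<in> E F"
      unfolding E_def using d(1)
      by (intro image_eqI[of _ _ "restrict d F"]) (auto simp: b_def fun_eq_iff)
    then have b: "b \<in> B" using F(1) by (auto simp: B_def)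
    define p q where "p = (\<lambda>k. if k \<in> F then u k - d k else 0)" 
      and "q = (\<lambda>k. if k \<in> F then 0 else u k)"
    have p: "finite_energy w p" "energy w p = (\<Sum>k\<in>F. (w k * cmod (p k))\<^sup>2)"
      by (rule finite_energy_finite_support[OF F(1)]; simp add: p_def)+
    have "energy w p \<le> (\<Sum>k\<in>F. r)"
      unfolding p(2) by (rule sum_mono) (use d(2) in \<open>auto simp: p_def less_imp_le\<close>)
    also have "\<dots> \<le> e / 4" using e by (simp add: r_def field_simps)
    finally have pe: "energy w p \<le> e / 4" .
    have "finite_energy w q"
      by (rule energy_dominated[OF u, of 1]) (auto simp: q_def)
    with energy_add(2)[OF p(1) this] pe F(2)[OF order_refl] have "energy w (\<lambda>k. p k + q k) < e"
      by (simp add: q_def)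
    moreover have "(\<lambda>k. p k + q k) = (\<lambda>k. u k - b k)" by (auto simp: p_def q_def b_def)
    ultimately show ?thesis using b by auto
  qed
  have "W.metric.mtopology closure_of B = vecs (weighted_space w)"
  proof (rule set_eqI)
    fix u
    have "\<exists>b\<in>B. b \<in> W.metric.mball u r" if u: "u \<in> vecs (weighted_space w)" and "r > 0" for r
    proof -
      obtain b where b: "b \<in> B" "energy w (\<lambda>k. u k - b k) < r\<^sup>2"
        using dense[of u "r\<^sup>2"] \<open>r > 0\<close> u by (auto simp: vecs_weighted[OF w])
      have "sqrt (energy w (\<lambda>k. u k - b k)) < r"
        using b(2) \<open>r > 0\<close> by (simp add: real_less_lsqrt energy_nonneg)
      moreover have "b \<in> vecs (weighted_space w)"
        using B_fin[OF b(1)] by (simp add: vecs_weighted[OF w])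
      ultimately have "b \<in> W.metric.mball u r"
        using u by (simp add: vdist_weighted)
      then show ?thesis using b(1) by blast
    qed
    then show "u \<in> W.metric.mtopology closure_of B \<longleftrightarrow> u \<in> vecs (weighted_space w)"
      by (auto simp: W.metric.metric_closure_of)
  qed
  moreover have "B \<subseteq> vecs (weighted_space w)"
    using B_fin by (auto simp: vecs_weighted[OF w])
  ultimately show ?thesis
    using B unfolding separable_space_def vtopology_def by auto
qed

lemma admissible_weight_bracket_powr: "admissible_weight (\<lambda>k. bracket k powr s)"
  unfolding admissible_weight_def
proof (intro conjI allI)
  show "0 < bracket k powr s" for k :: "int ^ 'n"
    using bracket_pos[of k] by simp
  have "\<forall>k :: int ^ 'n. 1 * bracket k powr s \<le> bracket k powr s" by simp
  then show "\<exists>c>0. \<exists>s'. \<forall>k :: int ^ 'n. c * bracket k powr s' \<le> bracket k powr s"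
    using zero_less_one by blast
qed

lemma bounded_linear_map_weighted_embedding:
  assumes "admissible_weight w" "admissible_weight w'" and "C \<ge> 0" 
    and le: "\<And>k. w' k \<le> C * w k"
  shows "bounded_linear_map (weighted_space w) (weighted_space w') (\<lambda>u. u)"
proof -
  have pos: "w k > 0" "w' k > 0" for k
    using assms(1,2) unfolding admissible_weight_def by blast+
  have dom: "\<bar>w' k * cmod (u k)\<bar> \<le> C * \<bar>w k * cmod (u k)\<bar>" for k u
    using mult_right_mono[OF le[of k], of "cmod (u k)"] pos[of k]
    by (simp add: abs_mult)
  have fin: "finite_energy w' u" and le: "sqrt (energy w' u) \<le> C * sqrt (energy w u)"
    if u: "finite_energy w u" for u
  proof -
    show "finite_energy w' u" by (rule energy_dominated(1)[OF u \<open>C \<ge> 0\<close>]) (rule dom)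
    have "energy w' u \<le> C\<^sup>2 * energy w u" by (rule energy_dominated(2)[OF u \<open>C \<ge> 0\<close>]) (rule dom)
    then show "sqrt (energy w' u) \<le> C * sqrt (energy w u)"
      using real_sqrt_le_mono \<open>C \<ge> 0\<close> by (fastforce simp: real_sqrt_mult)
  qed
  show ?thesis
    unfolding bounded_linear_map_def linear_map_def vnorm_weighted
    using fin le by (auto simp: vecs_weighted assms(1,2) weighted_ops intro!: exI[of _ C])
qed

lemma complex_hilbert_space_sobolev: "complex_hilbert_space (sobolev s)"
  unfolding sobolev_def by (rule complex_hilbert_space_weighted[OF admissible_weight_bracket_powr])

lemma complex_inner_space_sobolev: "complex_inner_space (sobolev s)"
  unfolding sobolev_def by (rule complex_inner_space_weighted[OF admissible_weight_bracket_powr])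

lemma sobolev_embedding:
  assumes "s0 \<le> s1"
  shows "continuously_embedded (sobolev s1 :: (int ^ 'n \<Rightarrow> complex) ip_space) (sobolev s0)"
proof -
  have "bracket k powr s0 \<le> 1 * bracket k powr s1" for k :: "int ^ 'n"
    using assms bracket_ge_1[of k] by (simp add: powr_mono)
  then have "bounded_linear_map (sobolev s1 :: (int ^ 'n \<Rightarrow> complex) ip_space) (sobolev s0) (\<lambda>u. u)"
    unfolding sobolev_def
    by (intro bounded_linear_map_weighted_embedding[of _ _ 1] admissible_weight_bracket_powr) auto
  then show ?thesis
    by (simp add: continuously_embedded_iff complex_inner_space_sobolev)
qed

lemma hilbert_scale_sobolev: "hilbert_scale sobolev"
  unfolding hilbert_scale_def
  by (intro conjI allI impI complex_hilbert_space_sobolev sobolev_embedding less_imp_le)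

lemma admissible_pair_sobolev: "s0 \<le> s1 \<Longrightarrow> admissible_pair (sobolev s0) (sobolev s1)"
  unfolding admissible_pair_def
  by (intro conjI complex_hilbert_space_sobolev sobolev_embedding)
    (auto simp only: sobolev_def intro: separable_weighted admissible_weight_bracket_powr)


section \<open>Operators bounded for two weights\<close>

lemma bounded_linear_map_compose:
  assumes "complex_inner_space K" and f: "bounded_linear_map H K f" and g: "bounded_linear_map K L g"
  shows "bounded_linear_map H L (\<lambda>x. g (f x))"
proof -
  interpret K: complex_inner_space K by fact
  obtain C where C: "\<And>x. x \<in> vecs H \<Longrightarrow> vnorm K (f x) \<le> C * vnorm H x"
    using f by (auto simp: bounded_linear_map_def)
  obtain D where D: "\<And>y. y \<in> vecs K \<Longrightarrow> vnorm L (g y) \<le> D * vnorm K y"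
    using g by (auto simp: bounded_linear_map_def)
  have "vnorm L (g (f x)) \<le> (\<bar>D\<bar> * C) * vnorm H x" if x: "x \<in> vecs H" for x
  proof -
    have fx: "f x \<in> vecs K" using f x by (auto simp: bounded_linear_map_def linear_map_def)
    have "vnorm L (g (f x)) \<le> D * vnorm K (f x)" by (rule D[OF fx])
    also have "\<dots> \<le> \<bar>D\<bar> * vnorm K (f x)"
      by (intro mult_right_mono K.norm_nonneg fx) auto
    also have "\<dots> \<le> \<bar>D\<bar> * (C * vnorm H x)"
      by (intro mult_left_mono C x) auto
    finally show ?thesis by (simp add: mult.assoc)
  qed
  then show ?thesis
    using f g by (auto simp: bounded_linear_map_def linear_map_def image_subset_iff)
qed

lemma norm_equivalence_bounded:
  assumes "equal_up_to_norm_equivalence S K"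
  shows "bounded_linear_map S K (\<lambda>x. x)" and "bounded_linear_map K S (\<lambda>x. x)"
proof -
  obtain c C where c: "0 < c" "0 < C"
    and bounds: "\<And>x. x \<in> vecs S \<Longrightarrow> c * vnorm K x \<le> vnorm S x \<and> vnorm S x \<le> C * vnorm K x"
    and eq: "vecs S = vecs K" "linear_map S K (\<lambda>x. x)"
    using assms by (auto simp: equal_up_to_norm_equivalence_def)
  have "vnorm K x \<le> (1 / c) * vnorm S x" if "x \<in> vecs S" for x
    using bounds[OF that] c by (simp add: field_simps)
  then show "bounded_linear_map S K (\<lambda>x. x)"
    unfolding bounded_linear_map_def using eq(2) by blast
  show "bounded_linear_map K S (\<lambda>x. x)"
    using eq bounds by (auto simp: bounded_linear_map_def linear_map_def)
qed

text \<open>The function is split according to which of the two weights is the smaller one.  On each part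
  the minimum coincides with a multiple of one weight, for which the operator is bounded, and the
  image is measured in the minimum, which is below both.  The resulting constant does not depend
  on \<open>\<alpha>\<close> and \<open>\<beta>\<close>; this uniformity allows the bounds to be summed over all dyadic scales.\<close>

lemma bounded_on_minimum_weight:
  fixes a b :: "'k \<Rightarrow> real"
  assumes pos: "\<And>k. 0 < a k" "\<And>k. 0 < b k" and \<alpha>: "0 < \<alpha>" and \<beta>: "0 < \<beta>"
    and Ta: "\<And>u. finite_energy a u \<Longrightarrow> finite_energy a (T u) \<and> energy a (T u) \<le> C * energy a u"
    and Tb: "\<And>u. finite_energy b u \<Longrightarrow> finite_energy b (T u) \<and> energy b (T u) \<le> C * energy b u"
    and add: "\<And>u v. finite_energy a u \<Longrightarrow> finite_energy a v \<Longrightarrow>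
      T (\<lambda>k. u k + v k) = (\<lambda>k. T u k + T v k)"
    and C: "0 \<le> C"
    and u: "finite_energy a u"
  defines "w \<equiv> \<lambda>k. min (\<alpha> * a k) (\<beta> * b k)"
  shows "finite_energy w u" and "finite_energy w (T u)" and "energy w (T u) \<le> 4 * C * energy w u"
proof -
  have wpos: "0 < w k" for k using pos[of k] \<alpha> \<beta> by (simp add: w_def)
  have wa: "finite_energy w v \<and> energy w v \<le> \<alpha>\<^sup>2 * energy a v" if v: "finite_energy a v" for v
  proof -
    have "\<bar>w k * cmod (v k)\<bar> \<le> \<alpha> * \<bar>a k * cmod (v k)\<bar>" for k
      using mult_right_mono[of "w k" "\<alpha> * a k" "cmod (v k)"] wpos[of k] pos(1)[of k]
      by (simp add: abs_mult w_def)
    then show ?thesis using energy_dominated[OF v, of \<alpha>] \<alpha> by simp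
  qed
  have wb: "finite_energy w v \<and> energy w v \<le> \<beta>\<^sup>2 * energy b v" if v: "finite_energy b v" for v
  proof -
    have "\<bar>w k * cmod (v k)\<bar> \<le> \<beta> * \<bar>b k * cmod (v k)\<bar>" for k
      using mult_right_mono[of "w k" "\<beta> * b k" "cmod (v k)"] wpos[of k] pos(2)[of k]
      by (simp add: abs_mult w_def)
    then show ?thesis using energy_dominated[OF v, of \<beta>] \<beta> by simp
  qed
  show wu: "finite_energy w u" using wa[OF u] by simp
  define u0 u1 where "u0 = (\<lambda>k. if \<alpha> * a k \<le> \<beta> * b k then u k else 0)"
    and "u1 = (\<lambda>k. if \<alpha> * a k \<le> \<beta> * b k then 0 else u k)"
  have split: "u = (\<lambda>k. u0 k + u1 k)" by (auto simp: u0_def u1_def)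
  have "\<bar>a k * cmod (u0 k)\<bar> \<le> (1 / \<alpha>) * \<bar>w k * cmod (u k)\<bar>" for k
    using \<alpha> pos(1)[of k] wpos[of k] by (auto simp: u0_def w_def abs_mult)
  then have u0: "finite_energy a u0" "energy a u0 \<le> (1 / \<alpha>)\<^sup>2 * energy w u"
    using energy_dominated[OF wu, of "1 / \<alpha>"] \<alpha> by auto
  have "\<bar>b k * cmod (u1 k)\<bar> \<le> (1 / \<beta>) * \<bar>w k * cmod (u k)\<bar>" for k
    using \<beta> pos(2)[of k] wpos[of k] by (auto simp: u1_def w_def abs_mult)
  then have u1: "finite_energy b u1" "energy b u1 \<le> (1 / \<beta>)\<^sup>2 * energy w u"
    using energy_dominated[OF wu, of "1 / \<beta>"] \<beta> by auto
  have u1a: "finite_energy a u1"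
    by (rule energy_dominated(1)[OF u, of 1]) (auto simp: u1_def)
  have Tu: "T u = (\<lambda>k. T u0 k + T u1 k)"
    using add[OF u0(1) u1a] split by simp
  have e0: "energy w (T u0) \<le> C * energy w u"
  proof -
    have "energy w (T u0) \<le> \<alpha>\<^sup>2 * energy a (T u0)" using wa Ta u0 by blast
    also have "\<dots> \<le> \<alpha>\<^sup>2 * (C * energy a u0)" using Ta u0 by (intro mult_left_mono) auto
    also have "\<dots> \<le> \<alpha>\<^sup>2 * (C * ((1 / \<alpha>)\<^sup>2 * energy w u))"
      using u0 C by (intro mult_left_mono) auto
    finally show ?thesis using \<alpha> by (simp add: power_divide)
  qed
  have e1: "energy w (T u1) \<le> C * energy w u"
  proof -
    have "energy w (T u1) \<le> \<beta>\<^sup>2 * energy b (T u1)" using wb Tb u1 by blast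
    also have "\<dots> \<le> \<beta>\<^sup>2 * (C * energy b u1)" using Tb u1 by (intro mult_left_mono) auto
    also have "\<dots> \<le> \<beta>\<^sup>2 * (C * ((1 / \<beta>)\<^sup>2 * energy w u))"
      using u1 C by (intro mult_left_mono) auto
    finally show ?thesis using \<beta> by (simp add: power_divide)
  qed
  have fin: "finite_energy w (T u0)" "finite_energy w (T u1)"
    using wa wb Ta Tb u0 u1 by blast+
  show "finite_energy w (T u)" "energy w (T u) \<le> 4 * C * energy w u"
    using energy_add[OF fin] e0 e1 by (simp_all add: Tu)
qed


section \<open>RO-varying weights are interpolation weights\<close>

text \<open>How far apart two positive numbers are on a logarithmic scale, regardless of their order.\<close>

definition ratio :: "real \<Rightarrow> real \<Rightarrow> real" where
  "ratio x y = max (x / y) (y / x)"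

lemma ratio_commute: "ratio x y = ratio y x"
  by (simp add: ratio_def max.commute)

lemma ratio_ge_1: "0 < x \<Longrightarrow> 0 < y \<Longrightarrow> 1 \<le> ratio x y"
  by (auto simp: ratio_def le_max_iff_disj divide_simps)

lemma ratio_eq_divide:
  assumes "0 < y" and "y \<le> x" shows "ratio x y = x / y"
proof -
  have "y / x \<le> 1" "1 \<le> x / y" using assms by auto
  then show ?thesis by (simp add: ratio_def)
qed

lemma RO_pos: "\<phi> \<in> RO \<Longrightarrow> 1 \<le> t \<Longrightarrow> 0 < \<phi> t"
  by (auto simp: RO_def)

text \<open>The defining condition controls \<open>\<phi>\<close> over one multiplicative step of size \<open>a\<close>.  Iterating it over
  about \<open>log a l\<close> steps costs \<open>c\<close> to that power, that is, a power of \<open>l\<close> with exponent \<open>log a c\<close>.\<close>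

lemma RO_growth:
  assumes \<phi>: "\<phi> \<in> RO"
  obtains c r where "1 \<le> c" and "0 \<le> r"
    and "\<And>x y. 1 \<le> x \<Longrightarrow> 1 \<le> y \<Longrightarrow> \<phi> x \<le> c * ratio x y powr r * \<phi> y"
proof -
  obtain a c where a: "1 < a" and c: "1 \<le> c"
    and ac: "\<And>t l. 1 \<le> t \<Longrightarrow> 1 \<le> l \<Longrightarrow> l \<le> a \<Longrightarrow>
      inverse c \<le> \<phi> (l * t) / \<phi> t \<and> \<phi> (l * t) / \<phi> t \<le> c"
    using \<phi> by (auto simp: RO_def)
  have pos: "0 < \<phi> t" if "1 \<le> t" for t using RO_pos[OF \<phi> that] .
  have step: "\<phi> (l * t) \<le> c * \<phi> t \<and> \<phi> t \<le> c * \<phi> (l * t)" if "1 \<le> t" "1 \<le> l" "l \<le> a" for t l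
    using ac[OF that] pos[OF that(1)] c by (simp add: field_simps)
  have steps: "\<phi> (l * t) \<le> c ^ n * \<phi> t \<and> \<phi> t \<le> c ^ n * \<phi> (l * t)"
    if "1 \<le> t" "1 \<le> l" "l \<le> a ^ n" for n t l
    using that
  proof (induction n arbitrary: l)
    case 0
    then show ?case by simp
  next
    case (Suc n)
    show ?case
    proof (cases "l \<le> a")
      case True
      have weaken: "x \<le> c ^ Suc n * y" if "x \<le> c * y" "0 < y" for x y
      proof -
        have "1 * (c * y) \<le> c ^ n * (c * y)"
          using that c by (intro mult_right_mono) auto
        then show ?thesis using that by (simp add: mult_ac)
      qed
      show ?thesis
        using step[of t l] weaken pos[of t] pos[of "l * t"] Suc.prems True mult_mono[of 1 l 1 t] by auto
    next
      case False
      define l' where "l' = l / a"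
      have l': "1 \<le> l'" "l' \<le> a ^ n" "l = a * l'"
        using False Suc.prems a by (auto simp: l'_def field_simps)
      have IH: "\<phi> (l' * t) \<le> c ^ n * \<phi> t" "\<phi> t \<le> c ^ n * \<phi> (l' * t)"
        using Suc.IH[of l'] Suc.prems l' by auto
      have st: "\<phi> (l * t) \<le> c * \<phi> (l' * t)" "\<phi> (l' * t) \<le> c * \<phi> (l * t)"
        using step[of "l' * t" a] mult_mono[of 1 l' 1 t] Suc.prems l' a by (auto simp: mult.assoc)
      have "c * \<phi> (l' * t) \<le> c * (c ^ n * \<phi> t)" "c ^ n * \<phi> (l' * t) \<le> c ^ n * (c * \<phi> (l * t))"
        using IH st c by (auto intro: mult_left_mono)
      then show ?thesis using st IH by (simp add: mult_ac)
    qed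
  qed
  define r where "r = log a c"
  have r: "0 \<le> r" using a c by (simp add: r_def)
  have up: "\<phi> (l * t) \<le> c * l powr r * \<phi> t \<and> \<phi> t \<le> c * l powr r * \<phi> (l * t)"
    if t: "1 \<le> t" and l: "1 \<le> l" for t l
  proof -
    define n where "n = nat \<lceil>log a l\<rceil>"
    have log: "0 \<le> log a l" using a l by simp
    then have n: "log a l \<le> real n" "real n \<le> log a l + 1" by (auto simp: n_def)
    have "l = a powr (log a l)" using a l by simp
    also have "\<dots> \<le> a powr (real n)" using a n by (intro powr_mono) auto
    finally have "l \<le> a ^ n" using a by (simp add: powr_realpow)
    note st = steps[OF t l this]
    have "c ^ n = c powr real n" using c by (simp add: powr_realpow)
    also have "\<dots> \<le> c powr (log a l + 1)" using c n by (intro powr_mono) auto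
    also have "\<dots> = c * c powr (log a l)" using c by (simp add: powr_add)
    also have "c powr (log a l) = l powr r"
      using a c l by (simp add: r_def powr_def log_def)
    finally have cn: "c ^ n \<le> c * l powr r" .
    have "1 \<le> l * t" using t l mult_mono[of 1 l 1 t] by simp
    then have "c ^ n * \<phi> t \<le> c * l powr r * \<phi> t" "c ^ n * \<phi> (l * t) \<le> c * l powr r * \<phi> (l * t)"
      using cn pos[OF t] pos[of "l * t"] by (auto intro!: mult_right_mono simp: less_imp_le)
    then show ?thesis using st by linarith
  qed
  have "\<phi> x \<le> c * ratio x y powr r * \<phi> y" if x: "1 \<le> x" and y: "1 \<le> y" for x y
  proof (cases "y \<le> x")
    case True
    then have "ratio x y = x / y" using y by (simp add: ratio_eq_divide)
    then show ?thesis using up[of y "x / y"] True x y by simp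
  next
    case False
    then have "ratio x y = y / x" using x by (simp add: ratio_commute[of x] ratio_eq_divide)
    then show ?thesis using up[of x "y / x"] False x y by simp
  qed
  then show ?thesis using that c r by blast
qed

lemma dyadic_floor:
  fixes x :: real
  assumes "1 \<le> x"
  obtains j :: nat where "2 ^ j \<le> x" and "x < 2 ^ Suc j"
proof -
  define j where "j = nat \<lfloor>log 2 x\<rfloor>"
  have log: "0 \<le> log 2 x" using assms by simp
  then have "real j \<le> log 2 x" "log 2 x < real (Suc j)" by (auto simp: j_def, linarith)
  then have "2 powr (real j) \<le> x" "x < 2 powr (real (Suc j))"
    using assms by (simp_all add: le_log_iff log_less_iff)
  then show ?thesis using that[of j] by (simp only: powr_realpow zero_less_numeral)
qed

text \<open>The terms decay geometrically on either side of the dyadic scale of \<open>x\<close>, so each side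
  contributes at most \<open>2\<close>.\<close>

lemma dyadic_sum_bound:
  assumes x: "1 \<le> x" and J: "finite J"
  shows "(\<Sum>j\<in>J. (1 / ratio x (2 ^ j))\<^sup>2) \<le> 4"
proof -
  obtain i :: nat where i: "2 ^ i \<le> x" "x < 2 ^ Suc i" using dyadic_floor[OF x] .
  define J1 J2 where "J1 = {j \<in> J. j \<le> i}" and "J2 = {j \<in> J. i < j}"
  have low: "(1 / ratio x (2 ^ j))\<^sup>2 \<le> (1 / 2) ^ (i - j)" if "j \<le> i" for j
  proof -
    have "ratio x (2 ^ j) \<ge> x / 2 ^ j" by (simp add: ratio_def)
    also have "x / 2 ^ j \<ge> 2 ^ i / 2 ^ j" using i by (intro divide_right_mono) auto
    also have "(2 :: real) ^ i / 2 ^ j = 2 ^ (i - j)" using that by (simp add: power_diff)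
    finally have "1 / ratio x (2 ^ j) \<le> 1 / 2 ^ (i - j)"
      by (intro divide_left_mono) (auto intro!: mult_pos_pos less_le_trans[of 0 "2 ^ (i - j)" "ratio x (2 ^ j)"])
    moreover have "0 \<le> 1 / ratio x (2 ^ j)" "1 / ratio x (2 ^ j) \<le> 1"
      using ratio_ge_1[of x "2 ^ j"] x by auto
    ultimately show ?thesis
      using mult_mono[of "1 / ratio x (2 ^ j)" "1 / 2 ^ (i - j)" "1 / ratio x (2 ^ j)" 1]
      by (simp add: power2_eq_square power_one_over)
  qed
  have high: "(1 / ratio x (2 ^ j))\<^sup>2 \<le> (1 / 2) ^ (j - Suc i)" if "i < j" for j
  proof -
    have "ratio x (2 ^ j) \<ge> 2 ^ j / x" by (simp add: ratio_def)
    also have "2 ^ j / x \<ge> 2 ^ j / 2 ^ Suc i" using i x by (intro divide_left_mono) auto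
    also have "(2 :: real) ^ j / 2 ^ Suc i = 2 ^ (j - Suc i)" using that by (simp add: power_diff del: power_Suc)
    finally have "1 / ratio x (2 ^ j) \<le> 1 / 2 ^ (j - Suc i)"
      by (intro divide_left_mono) (auto intro!: mult_pos_pos less_le_trans[of 0 "2 ^ (j - Suc i)" "ratio x (2 ^ j)"])
    moreover have "0 \<le> 1 / ratio x (2 ^ j)" "1 / ratio x (2 ^ j) \<le> 1"
      using ratio_ge_1[of x "2 ^ j"] x by auto
    ultimately show ?thesis
      using mult_mono[of "1 / ratio x (2 ^ j)" "1 / 2 ^ (j - Suc i)" "1 / ratio x (2 ^ j)" 1]
      by (simp add: power2_eq_square power_one_over)
  qed
  have geometric: "(\<Sum>j\<in>A. (1 / 2 :: real) ^ g j) \<le> 2" if "finite A" "inj_on g A" for A and g :: "nat \<Rightarrow> nat"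
  proof -
    have "(\<Sum>j\<in>A. (1 / 2 :: real) ^ g j) = (\<Sum>n\<in>g ` A. (1 / 2) ^ n)"
      using that by (simp add: sum.reindex)
    also have "\<dots> \<le> (\<Sum>n. (1 / 2) ^ n)"
      using that by (intro sum_le_suminf) auto
    also have "\<dots> = 2" by (simp add: suminf_geometric)
    finally show ?thesis .
  qed
  have "(\<Sum>j\<in>J1. (1 / ratio x (2 ^ j))\<^sup>2) \<le> (\<Sum>j\<in>J1. (1 / 2) ^ (i - j))"
    by (rule sum_mono) (use low in \<open>auto simp: J1_def\<close>)
  also have "\<dots> \<le> 2" using J by (intro geometric) (auto simp: J1_def inj_on_def)
  finally have 1: "(\<Sum>j\<in>J1. (1 / ratio x (2 ^ j))\<^sup>2) \<le> 2" .
  have "(\<Sum>j\<in>J2. (1 / ratio x (2 ^ j))\<^sup>2) \<le> (\<Sum>j\<in>J2. (1 / 2) ^ (j - Suc i))"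
    by (rule sum_mono) (use high in \<open>auto simp: J2_def\<close>)
  also have "\<dots> \<le> 2" using J by (intro geometric) (auto simp: J2_def inj_on_def)
  finally have 2: "(\<Sum>j\<in>J2. (1 / ratio x (2 ^ j))\<^sup>2) \<le> 2" .
  have "J = J1 \<union> J2" "J1 \<inter> J2 = {}" "finite J1" "finite J2"
    using J by (auto simp: J1_def J2_def)
  then show ?thesis using 1 2 by (simp add: sum.union_disjoint)
qed

text \<open>A sum over finitely many weights commutes with the sum over the lattice, so that a pointwise bound on
  the weights is enough.\<close>

lemma sum_energy_le:
  assumes "finite J" and v: "finite_energy v u" and fin: "\<And>j. j \<in> J \<Longrightarrow> finite_energy (w j) u"
    and le: "\<And>k. (\<Sum>j\<in>J. c j * (w j k)\<^sup>2) \<le> K * (v k)\<^sup>2"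
  shows "(\<Sum>j\<in>J. c j * energy (w j) u) \<le> K * energy v u"
proof (rule has_sum_mono)
  show "((\<lambda>k. \<Sum>j\<in>J. c j * (w j k * cmod (u k))\<^sup>2) has_sum (\<Sum>j\<in>J. c j * energy (w j) u)) UNIV"
    using \<open>finite J\<close> fin
  proof (induction J)
    case (insert i J)
    have "((\<lambda>k. c i * (w i k * cmod (u k))\<^sup>2) has_sum c i * energy (w i) u) UNIV"
      using insert.prems unfolding energy_def finite_energy_def
      by (intro has_sum_cmult_right has_sum_infsum) auto
    with insert show ?case by (simp add: has_sum_add)
  qed simp
  show "((\<lambda>k. K * (v k * cmod (u k))\<^sup>2) has_sum K * energy v u) UNIV"
    using v unfolding energy_def finite_energy_def by (intro has_sum_cmult_right has_sum_infsum)
  show "(\<Sum>j\<in>J. c j * (w j k * cmod (u k))\<^sup>2) \<le> K * (v k * cmod (u k))\<^sup>2" for k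
    using mult_right_mono[OF le[of k], of "(cmod (u k))\<^sup>2"]
    by (simp add: power_mult_distrib sum_distrib_left mult_ac)
qed

text \<open>With an exponent \<open>s\<close> one larger than the growth exponent of \<open>\<phi>\<close>, the decay of the kernel beats the
  growth of \<open>\<phi>\<close> by the square of the ratio.  The last two estimates say that \<open>\<phi>\<^sup>2\<close> is
  comparable with its discrete average against this kernel: from above by \<open>dyadic_sum_bound\<close>, and
  from below already by the single term at the dyadic scale of \<open>x\<close>.\<close>

lemma RO_weight_equivalent_dyadic:
  assumes \<phi>: "\<phi> \<in> RO"
  obtains s K where "0 < s" and "0 < K"
    and "\<And>x. 1 \<le> x \<Longrightarrow> \<phi> x \<le> K * x powr s"
    and "\<And>x. 1 \<le> x \<Longrightarrow> x powr (-s) \<le> K * \<phi> x"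
    and "\<And>x J. 1 \<le> x \<Longrightarrow> finite J \<Longrightarrow>
      (\<Sum>j\<in>J. (\<phi> (2 ^ j))\<^sup>2 * (ratio x (2 ^ j) powr (-s))\<^sup>2) \<le> K * (\<phi> x)\<^sup>2"
    and "\<And>x. 1 \<le> x \<Longrightarrow>
      \<exists>j. (\<phi> x)\<^sup>2 \<le> K * ((\<phi> (2 ^ j))\<^sup>2 * (ratio x (2 ^ j) powr (-s))\<^sup>2)"
proof -
  obtain c r where c: "1 \<le> c" and r: "0 \<le> r"
    and growth: "\<And>x y. 1 \<le> x \<Longrightarrow> 1 \<le> y \<Longrightarrow> \<phi> x \<le> c * ratio x y powr r * \<phi> y"
    using RO_growth[OF \<phi>] by blast
  have pos: "0 < \<phi> t" if "1 \<le> t" for t using RO_pos[OF \<phi> that] .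
  define s where "s = r + 1"
  \<comment> \<open>\<open>K0\<close> covers the comparison with powers; the other two terms cover the dyadic sum and its main term.\<close>
  define K0 where "K0 = max (c * \<phi> 1) (c / \<phi> 1)"
  define K where "K = max K0 (max (4 * c\<^sup>2) (c\<^sup>2 * 2 powr (2 * r + 2 * s)))"
  have ratio1: "ratio x 1 = x" "ratio 1 x = x" if "1 \<le> x" for x
    using that by (simp_all add: ratio_commute[of 1] ratio_eq_divide)
  have "0 < 4 * c\<^sup>2" using c by simp
  then have K: "0 < K" by (simp add: K_def less_max_iff_disj)
  show ?thesis
  proof (rule that[of s K])
    show "0 < s" using r by (simp add: s_def)
    show "0 < K" by (fact K)
    fix x :: real assume x: "1 \<le> x"
    have xs: "x powr r \<le> x powr s" using x by (intro powr_mono) (auto simp: s_def)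
    show "\<phi> x \<le> K * x powr s"
    proof -
      have "\<phi> x \<le> (c * \<phi> 1) * x powr r" using growth[OF x, of 1] x by (simp add: ratio1 mult_ac)
      also have "\<dots> \<le> K * x powr s"
      proof (rule mult_mono)
        show "c * \<phi> 1 \<le> K" by (simp add: K_def K0_def)
      qed (use xs K in auto)
      finally show ?thesis .
    qed
    show "x powr (-s) \<le> K * \<phi> x"
    proof -
      have "\<phi> 1 \<le> c * x powr r * \<phi> x" using growth[OF _ x, of 1] x by (simp add: ratio1)
      also have "\<dots> \<le> c * x powr s * \<phi> x"
        using xs c pos[OF x] by (intro mult_right_mono mult_left_mono) auto
      finally have "x powr (-s) \<le> (c / \<phi> 1) * \<phi> x"
        using pos[of 1] x by (simp add: powr_minus field_simps)
      also have "\<dots> \<le> K * \<phi> x"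
        using pos[OF x] by (intro mult_right_mono) (auto simp: K_def K0_def)
      finally show ?thesis .
    qed
    show "\<exists>j. (\<phi> x)\<^sup>2 \<le> K * ((\<phi> (2 ^ j))\<^sup>2 * (ratio x (2 ^ j) powr (-s))\<^sup>2)"
    proof -
      obtain j :: nat where j: "2 ^ j \<le> x" "x < 2 ^ Suc j" using dyadic_floor[OF x] .
      define R where "R = ratio x (2 ^ j)"
      have R: "1 \<le> R" using x by (auto simp: R_def intro: ratio_ge_1)
      have "2 ^ j \<le> 2 * x" using j x by linarith
      then have "R \<le> 2" using j x by (simp add: R_def ratio_def divide_simps mult.commute)
      have p: "0 < \<phi> (2 ^ j)" by (intro pos) simp
      have "\<phi> x \<le> c * R powr r * \<phi> (2 ^ j)"
        using growth[OF x, of "2 ^ j"] by (simp add: R_def)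
      then have "(\<phi> x)\<^sup>2 \<le> (c * R powr r * \<phi> (2 ^ j))\<^sup>2"
        using pos[OF x] by (intro power_mono) auto
      also have "\<dots> = (c\<^sup>2 * R powr (2 * r + 2 * s)) * ((\<phi> (2 ^ j))\<^sup>2 * (R powr (-s))\<^sup>2)"
      proof -
        have "R powr (2 * r + 2 * s) = (R powr r)\<^sup>2 * (R powr s)\<^sup>2"
          by (simp add: power2_eq_square powr_add[symmetric])
        then show ?thesis using R by (simp add: power_mult_distrib powr_minus power_inverse)
      qed
      also have "\<dots> \<le> (c\<^sup>2 * 2 powr (2 * r + 2 * s)) * ((\<phi> (2 ^ j))\<^sup>2 * (R powr (-s))\<^sup>2)"
        using R \<open>R \<le> 2\<close> r by (intro mult_right_mono mult_left_mono powr_mono2) (auto simp: s_def)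
      also have "\<dots> \<le> K * ((\<phi> (2 ^ j))\<^sup>2 * (R powr (-s))\<^sup>2)"
        by (intro mult_right_mono) (auto simp: K_def)
      finally show ?thesis by (auto simp: R_def)
    qed
    fix J :: "nat set" assume J: "finite J"
    show "(\<Sum>j\<in>J. (\<phi> (2 ^ j))\<^sup>2 * (ratio x (2 ^ j) powr (-s))\<^sup>2) \<le> K * (\<phi> x)\<^sup>2"
    proof -
      have "(\<phi> (2 ^ j))\<^sup>2 * (ratio x (2 ^ j) powr (-s))\<^sup>2
          \<le> (c\<^sup>2 * (\<phi> x)\<^sup>2) * (1 / ratio x (2 ^ j))\<^sup>2" for j :: nat
      proof -
        define R where "R = ratio x (2 ^ j)"
        have R: "1 \<le> R" using x by (auto simp: R_def intro: ratio_ge_1)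
        have p: "0 < \<phi> (2 ^ j)" by (intro pos) simp
        have "\<phi> (2 ^ j) \<le> c * R powr r * \<phi> x"
          using growth[of "2 ^ j", OF _ x] by (simp add: R_def ratio_commute)
        then have "(\<phi> (2 ^ j))\<^sup>2 * (R powr (-s))\<^sup>2 \<le> (c * R powr r * \<phi> x)\<^sup>2 * (R powr (-s))\<^sup>2"
          using p by (intro mult_right_mono power_mono) auto
        also have "\<dots> = (c * \<phi> x * (R powr r * R powr (-s)))\<^sup>2"
          by (simp add: power_mult_distrib mult_ac)
        also have "R powr r * R powr (-s) = 1 / R"
          using R by (simp add: s_def powr_add[symmetric] powr_minus_divide)
        finally have "(\<phi> (2 ^ j))\<^sup>2 * (R powr (-s))\<^sup>2 \<le> (c\<^sup>2 * (\<phi> x)\<^sup>2) * (1 / R)\<^sup>2"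
          by (simp only: power_mult_distrib)
        then show ?thesis by (simp add: R_def)
      qed
      then have "(\<Sum>j\<in>J. (\<phi> (2 ^ j))\<^sup>2 * (ratio x (2 ^ j) powr (-s))\<^sup>2)
          \<le> (c\<^sup>2 * (\<phi> x)\<^sup>2) * (\<Sum>j\<in>J. (1 / ratio x (2 ^ j))\<^sup>2)"
        by (simp only: sum_distrib_left) (rule sum_mono)
      also have "\<dots> \<le> (c\<^sup>2 * (\<phi> x)\<^sup>2) * 4"
        by (intro mult_left_mono dyadic_sum_bound x J) auto
      also have "\<dots> \<le> K * (\<phi> x)\<^sup>2"
        using mult_right_mono[of "4 * c\<^sup>2" K "(\<phi> x)\<^sup>2"] by (simp add: K_def mult_ac)
      finally show ?thesis .
    qed
  qed
qed

lemma sobolev_bound_energy: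
  fixes T :: "(int ^ 'n \<Rightarrow> complex) \<Rightarrow> int ^ 'n \<Rightarrow> complex"
  assumes "bounded_linear_map (sobolev s) (sobolev s) T"
  obtains C where "0 \<le> C" and
    "\<And>u. finite_energy (\<lambda>k. bracket k powr s) u \<Longrightarrow>
      finite_energy (\<lambda>k. bracket k powr s) (T u) \<and>
      energy (\<lambda>k. bracket k powr s) (T u) \<le> C * energy (\<lambda>k. bracket k powr s) u"
proof -
  let ?w = "\<lambda>k :: int ^ 'n. bracket k powr s"
  note V = vecs_weighted[OF admissible_weight_bracket_powr, of s]
  obtain C where C: "\<And>u. finite_energy ?w u \<Longrightarrow> sqrt (energy ?w (T u)) \<le> C * sqrt (energy ?w u)"
    using assms by (auto simp: bounded_linear_map_def sobolev_def V vnorm_weighted)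
  have fin: "finite_energy ?w (T u)" if "finite_energy ?w u" for u
    using assms that by (auto simp: bounded_linear_map_def linear_map_def sobolev_def V)
  have "energy ?w (T u) \<le> C\<^sup>2 * energy ?w u" if "finite_energy ?w u" for u
    using power_mono[OF C[OF that], of 2] by (simp add: power_mult_distrib energy_nonneg)
  then show ?thesis using that[of "C\<^sup>2"] fin by simp
qed

text \<open>For each dyadic scale the kernel \<open>A j\<close> is the minimum of multiples of the two Sobolev weights, so
  the operator is bounded for it uniformly in \<open>j\<close>.  The bounds are added with the coefficients
  \<open>\<phi>(2\<^sup>j)\<^sup>2\<close>.  For a finite set of lattice points, finitely many scales suffice to
  dominate \<open>\<phi>\<^sup>2\<close> on it.\<close>

lemma sobolev_RO_bounded:
  fixes T :: "(int ^ 'n \<Rightarrow> complex) \<Rightarrow> int ^ 'n \<Rightarrow> complex"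
  assumes s: "0 < s" and K: "0 < K"
    and lower: "\<And>x. 1 \<le> x \<Longrightarrow> x powr (-s) \<le> K * \<phi> x"
    and upper_sum: "\<And>x J. 1 \<le> x \<Longrightarrow> finite J \<Longrightarrow>
      (\<Sum>j\<in>J. (\<phi> (2 ^ j))\<^sup>2 * (ratio x (2 ^ j) powr (-s))\<^sup>2) \<le> K * (\<phi> x)\<^sup>2"
    and lower_sum: "\<And>x. 1 \<le> x \<Longrightarrow>
      \<exists>j. (\<phi> x)\<^sup>2 \<le> K * ((\<phi> (2 ^ j))\<^sup>2 * (ratio x (2 ^ j) powr (-s))\<^sup>2)"
    and w: "admissible_weight (\<lambda>k :: int ^ 'n. \<phi> (bracket k))"
    and T0: "bounded_linear_map (sobolev (-s)) (sobolev (-s)) T"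
    and T1: "bounded_linear_map (sobolev s) (sobolev s) T"
  shows "bounded_linear_map (sobolev_RO \<phi>) (sobolev_RO \<phi>) T"
proof -
  let ?\<phi> = "\<lambda>k :: int ^ 'n. \<phi> (bracket k)"
  let ?a = "\<lambda>k :: int ^ 'n. bracket k powr (-s)"
  let ?b = "\<lambda>k :: int ^ 'n. bracket k powr s"
  have pos: "0 < ?\<phi> k" for k using w unfolding admissible_weight_def by blast
  obtain C0 where C0: "0 \<le> C0" "\<And>u. finite_energy ?a u \<Longrightarrow>
      finite_energy ?a (T u) \<and> energy ?a (T u) \<le> C0 * energy ?a u"
    using sobolev_bound_energy[OF T0] by blast
  obtain C1 where C1: "0 \<le> C1" "\<And>u. finite_energy ?b u \<Longrightarrow>
      finite_energy ?b (T u) \<and> energy ?b (T u) \<le> C1 * energy ?b u"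
    using sobolev_bound_energy[OF T1] by blast
  define C where "C = max C0 C1"
  have C: "0 \<le> C" "C0 \<le> C" "C1 \<le> C" using C0 by (auto simp: C_def)
  have Ta: "finite_energy ?a (T u) \<and> energy ?a (T u) \<le> C * energy ?a u" if "finite_energy ?a u" for u
    using C0(2)[OF that] mult_right_mono[OF C(2) energy_nonneg[of ?a u]] by linarith
  have Tb: "finite_energy ?b (T u) \<and> energy ?b (T u) \<le> C * energy ?b u" if "finite_energy ?b u" for u
    using C1(2)[OF that] mult_right_mono[OF C(3) energy_nonneg[of ?b u]] by linarith
  have Va: "vecs (sobolev (-s)) = {u :: int ^ 'n \<Rightarrow> complex. finite_energy ?a u}"
    unfolding sobolev_def by (rule vecs_weighted[OF admissible_weight_bracket_powr])
  have T_add: "T (\<lambda>k. u k + v k) = (\<lambda>k. T u k + T v k)" if "finite_energy ?a u" "finite_energy ?a v" for u v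
    using T0 that by (simp add: bounded_linear_map_def linear_map_def Va) (simp add: sobolev_def weighted_ops)
  have T_scale: "T (\<lambda>k. c * u k) = (\<lambda>k. c * T u k)" if "finite_energy ?a u" for c u
    using T0 that by (simp add: bounded_linear_map_def linear_map_def Va) (simp add: sobolev_def weighted_ops)
  have \<phi>a: "finite_energy ?a u" if u: "finite_energy ?\<phi> u" for u
  proof (rule energy_dominated(1)[OF u, of K])
    show "\<bar>?a k * cmod (u k)\<bar> \<le> K * \<bar>?\<phi> k * cmod (u k)\<bar>" for k
      using mult_right_mono[OF lower[OF bracket_ge_1[of k]], of "cmod (u k)"] pos[of k]
      by (simp add: abs_mult)
  qed (use K in simp)
  define A where "A = (\<lambda>(j :: nat) (k :: int ^ 'n). ratio (bracket k) (2 ^ j) powr (-s))"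
  \<comment> \<open>As \<open>-s\<close> is negative, the power of the larger of the two ratios is the smaller of their powers.\<close>
  have A_min: "A j = (\<lambda>k. min (((2 :: real) ^ j) powr s * ?a k) (((2 :: real) ^ j) powr (-s) * ?b k))" for j
  proof
    fix k :: "int ^ 'n"
    define x y where "x = bracket k" and "y = (2 :: real) ^ j"
    have xy: "0 < x" "0 < y" using bracket_pos[of k] by (auto simp: x_def y_def)
    have 1: "y powr s * x powr (-s) = (x / y) powr (-s)" "y powr (-s) * x powr s = (y / x) powr (-s)"
      using xy by (simp_all add: powr_minus powr_divide field_simps)
    have "max (x / y) (y / x) powr (-s) = min ((x / y) powr (-s)) ((y / x) powr (-s))"
    proof (cases "x / y \<le> y / x")
      case True
      then have "(y / x) powr (-s) \<le> (x / y) powr (-s)"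
        using xy s by (intro powr_mono2') auto
      then show ?thesis using True by (simp add: max_def min_def)
    next
      case False
      then have "(x / y) powr (-s) \<le> (y / x) powr (-s)"
        using xy s by (intro powr_mono2') auto
      then show ?thesis using False by (simp add: max_def min_def)
    qed
    then show "A j k = min (((2 :: real) ^ j) powr s * ?a k) (((2 :: real) ^ j) powr (-s) * ?b k)"
      using 1 by (simp add: A_def ratio_def x_def y_def)
  qed
  have A_bound: "finite_energy (A j) u \<and> finite_energy (A j) (T u) \<and> energy (A j) (T u) \<le> 4 * C * energy (A j) u"
    if u: "finite_energy ?a u" for j u
  proof -
    have "0 < ?a k" "0 < ?b k" for k using bracket_pos[of k] by simp_all
    moreover have "0 < ((2 :: real) ^ j) powr s" "0 < ((2 :: real) ^ j) powr (-s)" by simp_all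
    ultimately show ?thesis
      unfolding A_min using bounded_on_minimum_weight[of ?a ?b _ _ T C u] Ta Tb T_add C(1) u by blast
  qed
  have main: "finite_energy ?\<phi> (T u) \<and> energy ?\<phi> (T u) \<le> K * (4 * C * K) * energy ?\<phi> u"
    if u: "finite_energy ?\<phi> u" for u
  proof -
    have ua: "finite_energy ?a u" by (rule \<phi>a[OF u])
    have "\<exists>j. (?\<phi> k)\<^sup>2 \<le> K * ((\<phi> (2 ^ j))\<^sup>2 * (A j k)\<^sup>2)" for k
      unfolding A_def by (rule lower_sum[OF bracket_ge_1])
    then obtain g where g: "\<And>k. (?\<phi> k)\<^sup>2 \<le> K * ((\<phi> (2 ^ g k))\<^sup>2 * (A (g k) k)\<^sup>2)" by metis
    have "(\<Sum>k\<in>F. (?\<phi> k * cmod (T u k))\<^sup>2) \<le> K * (4 * C * K) * energy ?\<phi> u" if F: "finite F" for F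
    proof -
      define J where "J = g ` F"
      have J: "finite J" using F by (simp add: J_def)
      have "(?\<phi> k * cmod (T u k))\<^sup>2 \<le> K * (\<Sum>j\<in>J. (\<phi> (2 ^ j))\<^sup>2 * (A j k * cmod (T u k))\<^sup>2)"
        if k: "k \<in> F" for k
      proof -
        have "(?\<phi> k)\<^sup>2 * (cmod (T u k))\<^sup>2
            \<le> (K * ((\<phi> (2 ^ g k))\<^sup>2 * (A (g k) k)\<^sup>2)) * (cmod (T u k))\<^sup>2"
          by (intro mult_right_mono g) auto
        then have "(?\<phi> k * cmod (T u k))\<^sup>2 \<le> K * ((\<phi> (2 ^ g k))\<^sup>2 * (A (g k) k * cmod (T u k))\<^sup>2)"
          by (simp add: power_mult_distrib mult_ac)
        also have "\<dots> \<le> K * (\<Sum>j\<in>J. (\<phi> (2 ^ j))\<^sup>2 * (A j k * cmod (T u k))\<^sup>2)"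
          using J K k
          by (intro mult_left_mono member_le_sum[of "g k" J "\<lambda>j. (\<phi> (2 ^ j))\<^sup>2 * (A j k * cmod (T u k))\<^sup>2"])
            (auto simp: J_def)
        finally show ?thesis .
      qed
      then have "(\<Sum>k\<in>F. (?\<phi> k * cmod (T u k))\<^sup>2)
          \<le> (\<Sum>k\<in>F. K * (\<Sum>j\<in>J. (\<phi> (2 ^ j))\<^sup>2 * (A j k * cmod (T u k))\<^sup>2))"
        by (rule sum_mono)
      also have "\<dots> = K * (\<Sum>j\<in>J. (\<phi> (2 ^ j))\<^sup>2 * (\<Sum>k\<in>F. (A j k * cmod (T u k))\<^sup>2))"
        by (simp only: sum_distrib_left[symmetric]) (subst sum.swap, simp only: sum_distrib_left)
      also have "\<dots> \<le> K * (\<Sum>j\<in>J. (\<phi> (2 ^ j))\<^sup>2 * (4 * C * energy (A j) u))"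
        using A_bound[OF ua] K sum_le_energy[OF _ F]
        by (intro mult_left_mono sum_mono) (auto intro: order_trans)
      also have "\<dots> = K * (4 * C) * (\<Sum>j\<in>J. (\<phi> (2 ^ j))\<^sup>2 * energy (A j) u)"
        by (simp add: sum_distrib_left mult_ac)
      also have "\<dots> \<le> K * (4 * C) * (K * energy ?\<phi> u)"
      proof (intro mult_left_mono sum_energy_le J u)
        show "finite_energy (A j) u" for j using A_bound[OF ua] by blast
        show "(\<Sum>j\<in>J. (\<phi> (2 ^ j))\<^sup>2 * (A j k)\<^sup>2) \<le> K * (?\<phi> k)\<^sup>2" for k
          unfolding A_def by (rule upper_sum[OF bracket_ge_1 J])
      qed (use K C in simp)
      finally show ?thesis by (simp add: mult_ac)
    qed
    then show ?thesis by (auto intro: finite_energyI)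
  qed
  have "sqrt (energy ?\<phi> (T u)) \<le> sqrt (K * (4 * C * K)) * sqrt (energy ?\<phi> u)"
    if "finite_energy ?\<phi> u" for u
    using main[OF that] by (metis real_sqrt_le_mono real_sqrt_mult)
  then show ?thesis
    unfolding bounded_linear_map_def linear_map_def sobolev_RO_def vecs_weighted[OF w] vnorm_weighted weighted_ops
    using main T_add T_scale \<phi>a by blast
qed

lemma sobolev_RO_interpolation:
  fixes S :: "(int ^ 'n \<Rightarrow> complex) ip_space"
  assumes S: "complex_hilbert_space S" and \<phi>: "\<phi> \<in> RO"
    and eq: "equal_up_to_norm_equivalence S (sobolev_RO \<phi>)"
  shows "interpolation_space_scale sobolev S"
proof -
  obtain s K where s: "0 < s" and K: "0 < K"
    and upper: "\<And>x. 1 \<le> x \<Longrightarrow> \<phi> x \<le> K * x powr s"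
    and lower: "\<And>x. 1 \<le> x \<Longrightarrow> x powr (-s) \<le> K * \<phi> x"
    and sums: "\<And>x J. 1 \<le> x \<Longrightarrow> finite J \<Longrightarrow>
      (\<Sum>j\<in>J. (\<phi> (2 ^ j))\<^sup>2 * (ratio x (2 ^ j) powr (-s))\<^sup>2) \<le> K * (\<phi> x)\<^sup>2"
      "\<And>x. 1 \<le> x \<Longrightarrow>
      \<exists>j. (\<phi> x)\<^sup>2 \<le> K * ((\<phi> (2 ^ j))\<^sup>2 * (ratio x (2 ^ j) powr (-s))\<^sup>2)"
    by (rule RO_weight_equivalent_dyadic[OF \<phi>]) blast
  let ?\<phi> = "\<lambda>k :: int ^ 'n. \<phi> (bracket k)"
  have w: "admissible_weight ?\<phi>"
    unfolding admissible_weight_def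
  proof (intro conjI allI exI)
    show "0 < ?\<phi> k" for k by (rule RO_pos[OF \<phi> bracket_ge_1])
    show "0 < 1 / K" using K by simp
    show "1 / K * bracket k powr (-s) \<le> ?\<phi> k" for k :: "int ^ 'n"
      using lower[OF bracket_ge_1[of k]] K by (simp add: field_simps)
  qed
  let ?H = "sobolev_RO \<phi> :: (int ^ 'n \<Rightarrow> complex) ip_space"
  have inner: "complex_inner_space ?H"
    unfolding sobolev_RO_def by (rule complex_inner_space_weighted[OF w])
  interpret S: complex_hilbert_space S by (rule S)
  have innerS: "complex_inner_space S" by unfold_locales
  have up: "bounded_linear_map (sobolev s) ?H (\<lambda>u. u)"
    unfolding sobolev_def sobolev_RO_def
    by (rule bounded_linear_map_weighted_embedding[OF admissible_weight_bracket_powr w, of K])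
      (use K upper[OF bracket_ge_1] in auto)
  have low: "bounded_linear_map ?H (sobolev (-s)) (\<lambda>u. u)"
    unfolding sobolev_def sobolev_RO_def
    by (rule bounded_linear_map_weighted_embedding[OF w admissible_weight_bracket_powr, of K])
      (use K lower[OF bracket_ge_1] in auto)
  note SH = norm_equivalence_bounded[OF eq]
  have "interpolation_space_pair (sobolev (-s)) (sobolev s) S"
    unfolding interpolation_space_pair_def
  proof (intro conjI allI impI S)
    show "admissible_pair (sobolev (-s) :: (int ^ 'n \<Rightarrow> complex) ip_space) (sobolev s)"
      using s by (intro admissible_pair_sobolev) simp
    show "continuously_embedded (sobolev s) S"
      using bounded_linear_map_compose[OF inner up SH(2)]
      by (simp add: continuously_embedded_iff complex_inner_space_sobolev innerS)
    show "continuously_embedded S (sobolev (-s))"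
      using bounded_linear_map_compose[OF inner SH(1) low]
      by (simp add: continuously_embedded_iff complex_inner_space_sobolev innerS)
    fix T :: "(int ^ 'n \<Rightarrow> complex) \<Rightarrow> int ^ 'n \<Rightarrow> complex"
    assume "bounded_linear_map (sobolev (-s)) (sobolev (-s)) T"
      and "bounded_linear_map (sobolev s) (sobolev s) T"
    from sobolev_RO_bounded[OF s K lower sums w this]
    have "bounded_linear_map ?H ?H T" by blast
    from bounded_linear_map_compose[OF inner bounded_linear_map_compose[OF inner SH(1) this] SH(2)]
    show "bounded_linear_map S S T" .
  qed
  moreover have "-s < s" using s by simp
  ultimately show ?thesis
    unfolding interpolation_space_scale_def using hilbert_scale_sobolev by blast
qed


section \<open>Category, disjoint selection and weighted composition operators\<close>

text \<open>The Baire category theorem for the space of all subsets with the topology of agreement on finite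
  sets: if countably many closed families exhaust the power set, one of them contains a
  cylinder, the family of all sets with a prescribed trace on a finite set.  Otherwise the
  \<open>n\<close>-th family could be avoided by fixing finitely many further memberships, and the set defined by
  all these choices would lie in none of the families.\<close>

lemma cylinder_category:
  fixes K :: "nat \<Rightarrow> 'k set set"
  assumes cover: "\<And>A. \<exists>n. A \<in> K n"
    and closed: "\<And>n A. (\<And>F. finite F \<Longrightarrow> \<exists>A'\<in>K n. A' \<inter> F = A \<inter> F) \<Longrightarrow> A \<in> K n"
  shows "\<exists>n F A. finite F \<and> (\<forall>B. B \<inter> F = A \<inter> F \<longrightarrow> B \<in> K n)"
proof (rule ccontr)
  assume none: "\<not> ?thesis"
  have step: "\<exists>F' A'. finite F' \<and> F \<subseteq> F' \<and> A' \<inter> F = A \<inter> F \<and> (\<forall>B. B \<inter> F' = A' \<inter> F' \<longrightarrow> B \<notin> K n)"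
    if F: "finite F" for n F A
  proof -
    obtain A' where A': "A' \<inter> F = A \<inter> F" "A' \<notin> K n" using none F by metis
    obtain G where G: "finite G" "\<And>B. B \<in> K n \<Longrightarrow> B \<inter> G \<noteq> A' \<inter> G"
      using closed[of n A'] A'(2) by metis
    have "B \<notin> K n" if "B \<inter> (F \<union> G) = A' \<inter> (F \<union> G)" for B
      using G(2)[of B] that by blast
    then show ?thesis using F G(1) A'(1)
      by (intro exI[of _ "F \<union> G"] exI[of _ A'] conjI allI impI) simp_all
  qed
  define Q where "Q n x y \<longleftrightarrow> fst x \<subseteq> fst y \<and> snd y \<inter> fst x = snd x \<inter> fst x \<and>
    (\<forall>B. B \<inter> fst y = snd y \<inter> fst y \<longrightarrow> B \<notin> K n)" for n and x y :: "'k set \<times> 'k set"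
  have "\<exists>f. \<forall>n. finite (fst (f n)) \<and> Q n (f n) (f (Suc n))"
  proof (rule dependent_nat_choice)
    show "\<exists>x :: 'k set \<times> 'k set. finite (fst x)" by (rule exI[of _ "({}, {})"]) simp
    fix x :: "'k set \<times> 'k set" and n assume "finite (fst x)"
    from step[OF this, of "snd x" n] show "\<exists>y. finite (fst y) \<and> Q n x y"
      unfolding Q_def split_paired_Ex fst_conv snd_conv by blast
  qed
  then obtain f where f: "\<And>n. finite (fst (f n))" "\<And>n. Q n (f n) (f (Suc n))" by blast
  define F A where "F n = fst (f n)" and "A n = snd (f n)" for n
  have inc: "F n \<subseteq> F (Suc n)" and agree1: "A (Suc n) \<inter> F n = A n \<inter> F n"
    and avoid: "B \<inter> F (Suc n) = A (Suc n) \<inter> F (Suc n) \<Longrightarrow> B \<notin> K n" for n B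
    using f(2)[of n] by (auto simp: Q_def F_def A_def)
  have mono: "F m \<subseteq> F n" if "m \<le> n" for m n
    using that by (rule lift_Suc_mono_le[of F, OF inc])
  have agree: "A n \<inter> F m = A m \<inter> F m" if "m \<le> n" for m n
    using that
  proof (induction n rule: dec_induct)
    case (step n)
    have "A (Suc n) \<inter> F m = (A (Suc n) \<inter> F n) \<inter> F m" using mono[OF step(1)] by blast
    also have "\<dots> = A n \<inter> F m" unfolding agree1 using mono[OF step(1)] by blast
    finally show ?case using step by simp
  qed simp
  define L where "L = (\<Union>n. A n \<inter> F n)"
  have "L \<inter> F n = A n \<inter> F n" for n
  proof -
    have "A m \<inter> F m \<inter> F n \<subseteq> A n \<inter> F n" for m
      using agree[of m n] agree[of n m] mono[of m n] by (cases "m \<le> n") auto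
    then show ?thesis unfolding L_def by blast
  qed
  then have "L \<notin> K n" for n using avoid by blast
  then show False using cover by blast
qed

text \<open>The gliding hump: bad witnesses that exist away from every finite set can be chosen with
  pairwise disjoint supports.\<close>

lemma disjoint_selection:
  fixes supp :: "'x \<Rightarrow> 'k set"
  assumes "\<And>n F. finite F \<Longrightarrow> \<exists>x. P n x \<and> finite (supp x) \<and> supp x \<inter> F = {}"
  obtains x :: "nat \<Rightarrow> 'x" where "\<And>n. P n (x n)" and "\<And>m n. m \<noteq> n \<Longrightarrow> supp (x m) \<inter> supp (x n) = {}"
proof -
  define f where "f n F = (SOME x. P n x \<and> finite (supp x) \<and> supp x \<inter> F = {})" for n F
  have f: "P n (f n F) \<and> finite (supp (f n F)) \<and> supp (f n F) \<inter> F = {}" if "finite F" for n F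
    unfolding f_def by (rule someI_ex[OF assms[OF that]])
  define G where "G = rec_nat {} (\<lambda>n G. G \<union> supp (f n G))"
  have G: "G 0 = {}" "\<And>n. G (Suc n) = G n \<union> supp (f n (G n))" by (auto simp: G_def)
  have fin: "finite (G n)" for n by (induction n) (auto simp: G f)
  have inc: "G n \<subseteq> G (Suc n)" for n by (simp add: G)
  have mono: "G m \<subseteq> G n" if "m \<le> n" for m n
    using that by (rule lift_Suc_mono_le[of G, OF inc])
  define x where "x n = f n (G n)" for n
  have "supp (x m) \<inter> supp (x n) = {}" if "m < n" for m n
  proof -
    have "supp (x m) \<subseteq> G n" using mono[of "Suc m" n] that by (auto simp: G x_def)
    then show ?thesis using f[OF fin[of n], of n] by (auto simp: x_def)
  qed
  then have "supp (x m) \<inter> supp (x n) = {}" if "m \<noteq> n" for m n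
    using that by (metis inf_commute nat_neq_iff)
  moreover have "P n (x n)" for n using f fin by (simp add: x_def)
  ultimately show ?thesis using that by blast
qed

lemma powr_comparable:
  fixes x y R :: real
  assumes "0 < x" "0 < y" "x \<le> R * y" "y \<le> R * x" "1 \<le> R"
  shows "x powr s \<le> R powr \<bar>s\<bar> * y powr s"
proof (cases "0 \<le> s")
  case True
  have "x powr s \<le> (R * y) powr s" using assms True by (intro powr_mono2) auto
  then show ?thesis using True assms by (simp add: powr_mult)
next
  case False
  have "x powr s = (1 / x) powr \<bar>s\<bar>" using False assms by (simp add: powr_minus powr_divide field_simps)
  also have "\<dots> \<le> (R * (1 / y)) powr \<bar>s\<bar>" using assms by (intro powr_mono2) (auto simp: field_simps)
  also have "\<dots> = R powr \<bar>s\<bar> * (1 / y) powr \<bar>s\<bar>" by (rule powr_mult)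
  also have "(1 / y) powr \<bar>s\<bar> = y powr s" using False assms by (simp add: powr_minus powr_divide field_simps)
  finally show ?thesis .
qed

text \<open>The Sobolev weights at \<open>x\<close> and \<open>\<sigma> x\<close> differ by a bounded factor, and injectivity of \<open>\<sigma>\<close>
  ensures that no value is counted twice.  The two uses are multiplication by a bounded function and
  moving point masses to lattice points of comparable size.\<close>

lemma weighted_composition_bounded:
  fixes m :: "int ^ 'n \<Rightarrow> complex" and \<sigma> :: "int ^ 'n \<Rightarrow> int ^ 'n"
  assumes m: "\<And>x. cmod (m x) \<le> 1" and inj: "inj_on \<sigma> {x. m x \<noteq> 0}" and R: "1 \<le> R"
    and comparable: "\<And>x. m x \<noteq> 0 \<Longrightarrow> bracket x \<le> R * bracket (\<sigma> x) \<and> bracket (\<sigma> x) \<le> R * bracket x"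
  shows "bounded_linear_map (sobolev s) (sobolev s) (\<lambda>u x. m x * u (\<sigma> x))"
proof -
  let ?w = "\<lambda>k :: int ^ 'n. bracket k powr s"
  let ?C = "(R powr \<bar>s\<bar>)\<^sup>2"
  have V: "vecs (sobolev s) = {u :: int ^ 'n \<Rightarrow> complex. finite_energy ?w u}"
    unfolding sobolev_def by (rule vecs_weighted[OF admissible_weight_bracket_powr])
  have main: "finite_energy ?w (\<lambda>x. m x * u (\<sigma> x)) \<and> energy ?w (\<lambda>x. m x * u (\<sigma> x)) \<le> ?C * energy ?w u"
    if u: "finite_energy ?w u" for u
  proof -
    have "(\<Sum>x\<in>F. (?w x * cmod (m x * u (\<sigma> x)))\<^sup>2) \<le> ?C * energy ?w u" if F: "finite F" for F
    proof -
      let ?F = "{x \<in> F. m x \<noteq> 0}"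
      have inj': "inj_on \<sigma> ?F" using inj by (rule inj_on_subset) auto
      have "(\<Sum>x\<in>F. (?w x * cmod (m x * u (\<sigma> x)))\<^sup>2) = (\<Sum>x\<in>?F. (?w x * cmod (m x * u (\<sigma> x)))\<^sup>2)"
        using F by (intro sum.mono_neutral_right) auto
      also have "\<dots> \<le> (\<Sum>x\<in>?F. ?C * (?w (\<sigma> x) * cmod (u (\<sigma> x)))\<^sup>2)"
      proof (rule sum_mono)
        fix x assume x: "x \<in> ?F"
        have "?w x \<le> R powr \<bar>s\<bar> * ?w (\<sigma> x)"
          using comparable[of x] x R by (intro powr_comparable bracket_pos) auto
        moreover have "cmod (m x * u (\<sigma> x)) \<le> 1 * cmod (u (\<sigma> x))"
          unfolding norm_mult by (intro mult_right_mono m) auto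
        ultimately have "?w x * cmod (m x * u (\<sigma> x)) \<le> (R powr \<bar>s\<bar> * ?w (\<sigma> x)) * (1 * cmod (u (\<sigma> x)))"
          by (intro mult_mono) auto
        then have "(?w x * cmod (m x * u (\<sigma> x)))\<^sup>2 \<le> (R powr \<bar>s\<bar> * ?w (\<sigma> x) * cmod (u (\<sigma> x)))\<^sup>2"
          by (intro power_mono) auto
        then show "(?w x * cmod (m x * u (\<sigma> x)))\<^sup>2 \<le> ?C * (?w (\<sigma> x) * cmod (u (\<sigma> x)))\<^sup>2"
          by (simp add: power_mult_distrib)
      qed
      also have "\<dots> = ?C * (\<Sum>y\<in>\<sigma> ` ?F. (?w y * cmod (u y))\<^sup>2)"
        by (simp add: sum.reindex[OF inj'] sum_distrib_left)
      also have "\<dots> \<le> ?C * energy ?w u"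
        using F by (intro mult_left_mono sum_le_energy u) auto
      finally show ?thesis .
    qed
    then show ?thesis by (auto intro: finite_energyI)
  qed
  have "sqrt (energy ?w (\<lambda>x. m x * u (\<sigma> x))) \<le> sqrt ?C * sqrt (energy ?w u)" if "finite_energy ?w u" for u
    using main[OF that] by (metis real_sqrt_le_mono real_sqrt_mult)
  then show ?thesis
    unfolding bounded_linear_map_def linear_map_def V
    using main by (auto simp: sobolev_def weighted_ops vnorm_weighted algebra_simps intro!: exI[of _ "sqrt ?C"])
qed

definition delta :: "'k \<Rightarrow> 'k \<Rightarrow> complex" where
  "delta k = (\<lambda>j. if j = k then 1 else 0)"

definition restricted :: "'k set \<Rightarrow> ('k \<Rightarrow> complex) \<Rightarrow> 'k \<Rightarrow> complex" where
  "restricted A u = (\<lambda>k. if k \<in> A then u k else 0)"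


section \<open>Interpolation spaces are weighted spaces\<close>

locale sobolev_interpolation = complex_hilbert_space S
  for S :: "(int ^ 'n \<Rightarrow> complex) ip_space" +
  fixes s0 s1 :: real
  assumes pair: "interpolation_space_pair (sobolev s0) (sobolev s1) S"
begin

lemma inner_space: "complex_inner_space S" by unfold_locales

lemma into_low: "bounded_linear_map S (sobolev s0) (\<lambda>u. u)"
  using pair continuously_embedded_iff[OF inner_space complex_inner_space_sobolev]
  by (simp add: interpolation_space_pair_def)

lemma from_high: "bounded_linear_map (sobolev s1) S (\<lambda>u. u)"
  using pair continuously_embedded_iff[OF complex_inner_space_sobolev inner_space]
  by (simp add: interpolation_space_pair_def)

text \<open>The embedding into a space of functions is linear, which forces the operations of \<open>S\<close> to be pointwise.\<close>

lemma add_eq: "u \<in> vecs S \<Longrightarrow> v \<in> vecs S \<Longrightarrow> vadd S u v = (\<lambda>k. u k + v k)"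
  using into_low by (simp add: bounded_linear_map_def linear_map_def sobolev_def weighted_ops)

lemma scale_eq: "u \<in> vecs S \<Longrightarrow> vscale S a u = (\<lambda>k. a * u k)"
  using into_low by (simp add: bounded_linear_map_def linear_map_def sobolev_def weighted_ops)

lemma zero_eq: "vzero S = (\<lambda>k. 0)"
  using linear_map_zero[OF inner_space complex_inner_space_sobolev, of s0 "\<lambda>u. u"] into_low
  by (simp add: bounded_linear_map_def sobolev_def weighted_ops)

lemma plus_closed: "u \<in> vecs S \<Longrightarrow> v \<in> vecs S \<Longrightarrow> (\<lambda>k. u k + v k) \<in> vecs S"
  using add_closed[of u v] by (simp add: add_eq)

lemma times_closed: "u \<in> vecs S \<Longrightarrow> (\<lambda>k. a * u k) \<in> vecs S"
  using scale_closed[of u a] by (simp add: scale_eq)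

lemma norm_plus: "u \<in> vecs S \<Longrightarrow> v \<in> vecs S \<Longrightarrow> vnorm S (\<lambda>k. u k + v k) \<le> vnorm S u + vnorm S v"
  using norm_triangle[of u v] by (simp add: add_eq)

lemma norm_times: "u \<in> vecs S \<Longrightarrow> vnorm S (\<lambda>k. a * u k) = cmod a * vnorm S u"
  using norm_scale[of u a] by (simp add: scale_eq)

lemma minus_closed: "u \<in> vecs S \<Longrightarrow> v \<in> vecs S \<Longrightarrow> (\<lambda>k. u k - v k) \<in> vecs S"
  using plus_closed[of u "\<lambda>k. (-1) * v k"] times_closed[of v "-1"] by simp

lemma norm_parallelogram:
  assumes "u \<in> vecs S" "v \<in> vecs S"
  shows "(vnorm S (\<lambda>k. u k + v k))\<^sup>2 + (vnorm S (\<lambda>k. u k - v k))\<^sup>2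
       = 2 * ((vnorm S u)\<^sup>2 + (vnorm S v)\<^sup>2)"
  using parallelogram[OF assms] assms times_closed[of v "-1"] by (simp add: add_eq scale_eq)

lemma dist_eq: "u \<in> vecs S \<Longrightarrow> v \<in> vecs S \<Longrightarrow> vdist S u v = vnorm S (\<lambda>k. u k - v k)"
  using times_closed[of v "-1"] by (simp add: vdist_def add_eq scale_eq)

lemma finite_support_mem:
  assumes "finite {k. u k \<noteq> 0}" shows "u \<in> vecs S"
proof -
  have "u \<in> vecs (sobolev s1)"
    unfolding sobolev_def vecs_weighted[OF admissible_weight_bracket_powr]
    using finite_energy_finite_support(1)[OF assms] by simp
  then show ?thesis using from_high by (auto simp: bounded_linear_map_def linear_map_def)
qed

lemma delta_mem: "delta k \<in> vecs S"
  by (rule finite_support_mem) (simp add: delta_def)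

text \<open>Both facts come from the embedding into the larger Sobolev space, where the value at a point is
  controlled by the norm.\<close>

lemma evaluation_bounded: "\<exists>C>0. \<forall>u\<in>vecs S. bracket k powr s0 * cmod (u k) \<le> C * vnorm S u"
  and admissible_delta_norm: "admissible_weight (\<lambda>k. vnorm S (delta k))"
proof -
  let ?a = "\<lambda>k :: int ^ 'n. bracket k powr s0"
  obtain C where C: "\<And>u. u \<in> vecs S \<Longrightarrow> sqrt (energy ?a u) \<le> C * vnorm S u"
    using into_low by (auto simp: bounded_linear_map_def sobolev_def vnorm_weighted)
  define D where "D = \<bar>C\<bar> + 1"
  have D: "D > 0" by (simp add: D_def)
  have ev: "?a k * cmod (u k) \<le> D * vnorm S u" if u: "u \<in> vecs S" for k u
  proof -
    have "finite_energy ?a u"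
      using into_low u by (auto simp: bounded_linear_map_def linear_map_def sobolev_def
          vecs_weighted[OF admissible_weight_bracket_powr])
    then have "(?a k * cmod (u k))\<^sup>2 \<le> energy ?a u" using sum_le_energy[of ?a u "{k}"] by simp
    then have "?a k * cmod (u k) \<le> sqrt (energy ?a u)" by (rule real_le_rsqrt)
    also have "\<dots> \<le> C * vnorm S u" by (rule C[OF u])
    also have "\<dots> \<le> D * vnorm S u"
      by (intro mult_right_mono norm_nonneg u) (simp add: D_def)
    finally show ?thesis .
  qed
  then show "\<exists>C>0. \<forall>u\<in>vecs S. bracket k powr s0 * cmod (u k) \<le> C * vnorm S u" using D by blast
  have low: "?a k \<le> D * vnorm S (delta k)" for k
    using ev[OF delta_mem[of k], of k] by (simp add: delta_def)
  show "admissible_weight (\<lambda>k. vnorm S (delta k))"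
    unfolding admissible_weight_def
  proof (intro conjI allI exI)
    show "0 < vnorm S (delta k)" for k
    proof -
      have "0 < ?a k" using bracket_pos[of k] by simp
      then have "0 < D * vnorm S (delta k)" using low[of k] by linarith
      then show ?thesis using D by (simp add: zero_less_mult_iff)
    qed
    show "0 < 1 / D" using D by simp
    show "1 / D * ?a k \<le> vnorm S (delta k)" for k using low[of k] D by (simp add: field_simps)
  qed
qed

lemma evaluation_limit:
  assumes g: "\<And>n. g n \<in> vecs S" and lim: "limitin metric.mtopology g h sequentially"
  shows "(\<lambda>n. g n k) \<longlonglongrightarrow> h k"
proof -
  have h: "h \<in> vecs S" and conv: "(\<lambda>n. vdist S (g n) h) \<longlonglongrightarrow> 0"
    using lim by (auto simp: metric.limitin_metric_dist_null)
  obtain C where C: "C > 0" "\<And>u. u \<in> vecs S \<Longrightarrow> bracket k powr s0 * cmod (u k) \<le> C * vnorm S u"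
    using evaluation_bounded[of k] by blast
  have b: "bracket k powr s0 > 0" using bracket_pos[of k] by simp
  have "cmod (g n k - h k) \<le> (C / bracket k powr s0) * vdist S (g n) h" for n
    using C(2)[OF minus_closed[OF g[of n] h]] b by (simp add: dist_eq g h field_simps)
  moreover have "(\<lambda>n. (C / bracket k powr s0) * vdist S (g n) h) \<longlonglongrightarrow> 0"
    using tendsto_mult_left[OF conv, of "C / bracket k powr s0"] by simp
  ultimately have "(\<lambda>n. g n k - h k) \<longlonglongrightarrow> 0"
    by (intro Lim_null_comparison[of "\<lambda>n. g n k - h k"] always_eventually allI) auto
  then show ?thesis by (simp add: LIM_zero_iff)
qed

text \<open>A substitute for weak compactness of balls.  Among the elements of \<open>S\<close> that agree with \<open>f\<close> on a finite
  ball take one of almost minimal norm.  As the ball grows, the minimal norms increase and stay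
  bounded, and midpoints of two candidates are again candidates, so by the parallelogram law the
  chosen elements form a Cauchy sequence.  Its limit agrees with \<open>f\<close> because evaluation is continuous.\<close>

lemma ball_pointwise_closed:
  assumes approx: "\<And>F. finite F \<Longrightarrow> \<exists>g\<in>vecs S. vnorm S g \<le> R \<and> (\<forall>k\<in>F. g k = f k)"
  shows "f \<in> vecs S" and "vnorm S f \<le> R"
proof -
  define B where "B i = {k :: int ^ 'n. bracket k \<le> real i}" for i :: nat
  have B: "finite (B i)" for i unfolding B_def by (rule finite_bracket_ball)
  have B_mono: "B i \<subseteq> B j" if "i \<le> j" for i j using that by (auto simp: B_def)
  define E where "E i = {g \<in> vecs S. \<forall>k\<in>B i. g k = f k}" for i
  define d where "d i = (INF g\<in>E i. (vnorm S g)\<^sup>2)" for i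
  have E_mono: "E j \<subseteq> E i" if "i \<le> j" for i j using B_mono[OF that] by (auto simp: E_def)
  have bdd: "bdd_below ((\<lambda>g. (vnorm S g)\<^sup>2) ` X)" for X
    by (rule bdd_belowI[of _ 0]) auto
  have R: "\<exists>g\<in>E i. vnorm S g \<le> R" for i using approx[OF B[of i]] by (auto simp: E_def)
  then have ne: "E i \<noteq> {}" for i by blast
  have R0: "0 \<le> R" using R[of 0] norm_nonneg by (force simp: E_def)
  have d_le: "d i \<le> (vnorm S g)\<^sup>2" if "g \<in> E i" for g i
    unfolding d_def by (rule cINF_lower[OF bdd that])
  have d_mono: "d i \<le> d j" if "i \<le> j" for i j
    unfolding d_def by (rule cINF_superset_mono[OF ne bdd E_mono[OF that]]) auto
  have d_R: "d i \<le> R\<^sup>2" for i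
  proof -
    obtain g where g: "g \<in> E i" "vnorm S g \<le> R" using R by blast
    have "(vnorm S g)\<^sup>2 \<le> R\<^sup>2" using g by (intro power_mono norm_nonneg) (auto simp: E_def)
    then show ?thesis using d_le[OF g(1)] by linarith
  qed
  have "\<exists>g\<in>E i. (vnorm S g)\<^sup>2 < d i + inverse (real (Suc i))" for i
    using cINF_less_iff[OF ne[of i] bdd, of "d i + inverse (real (Suc i))"] by (simp add: d_def)
  then obtain g where g: "\<And>i. g i \<in> E i" "\<And>i. (vnorm S (g i))\<^sup>2 < d i + inverse (real (Suc i))"
    by metis
  have gS: "g i \<in> vecs S" for i using g(1)[of i] by (simp add: E_def)
  have dist: "(vdist S (g i) (g j))\<^sup>2 \<le> 2 * (d j - d i) + 4 * inverse (real (Suc i))" if ij: "i \<le> j" for i j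
  proof -
    define h where "h = (\<lambda>k. (1/2) * (g i k + g j k))"
    have sum: "(\<lambda>k. g i k + g j k) \<in> vecs S" by (rule plus_closed[OF gS gS])
    have "h \<in> vecs S" unfolding h_def by (rule times_closed[OF sum])
    then have "h \<in> E i" using g(1)[of i] g(1)[of j] B_mono[OF ij] by (auto simp: E_def h_def)
    then have "d i \<le> (vnorm S h)\<^sup>2" by (rule d_le)
    also have "\<dots> = (vnorm S (\<lambda>k. g i k + g j k))\<^sup>2 / 4"
      unfolding h_def by (subst norm_times[OF sum]) (simp add: power_mult_distrib norm_divide power_divide)
    finally have "4 * d i \<le> (vnorm S (\<lambda>k. g i k + g j k))\<^sup>2" by simp
    moreover have "inverse (real (Suc j)) \<le> inverse (real (Suc i))" using ij by simp
    moreover have "m \<le> 2 * (b - a) + 4 * x"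
      if "4 * a \<le> p" "y \<le> x" "p + m = 2 * (q + r)" "q < a + x" "r < b + y" for m p q r a b x y :: real
      using that by argo
    ultimately show ?thesis
      unfolding dist_eq[OF gS gS] using norm_parallelogram[OF gS gS, of i j] g(2)[of i] g(2)[of j] by blast
  qed
  have "0 \<le> d i" for i unfolding d_def by (rule cINF_greatest[OF ne]) simp
  then have "norm (d i) \<le> R\<^sup>2" for i using d_R[of i] by simp
  then have "Bseq d" by (rule BseqI')
  then have "convergent d" using d_mono by (intro Bseq_mono_convergent allI impI)
  then have Cau: "Cauchy d" by (rule convergent_Cauchy)
  have "metric.MCauchy g"
    unfolding metric.MCauchy_def
  proof (intro conjI allI impI)
    show "range g \<subseteq> vecs S" using gS by blast
    fix e :: real assume e: "e > 0"
    have "e\<^sup>2 / 8 > 0" using e by simp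
    from CauchyD[OF Cau this]
    obtain N1 where N1: "\<bar>d i - d j\<bar> < e\<^sup>2 / 8" if "N1 \<le> i" "N1 \<le> j" for i j
      unfolding real_norm_def by metis
    obtain N2 where N2: "inverse (real (Suc N2)) < e\<^sup>2 / 8"
      using reals_Archimedean[of "e\<^sup>2 / 8"] e by auto
    have *: "vdist S (g i) (g j) < e" if "max N1 N2 \<le> i" "i \<le> j" for i j
    proof -
      have "inverse (real (Suc i)) \<le> inverse (real (Suc N2))" using that by simp
      moreover have "d j - d i < e\<^sup>2 / 8"
        using le_less_trans[OF abs_ge_self N1[of j i]] that by simp
      ultimately have "(vdist S (g i) (g j))\<^sup>2 < e\<^sup>2"
        using dist[OF that(2)] N2 \<open>e\<^sup>2 / 8 > 0\<close> by argo
      then show ?thesis using e by (intro power2_less_imp_less[of _ e]) auto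
    qed
    show "\<exists>N. \<forall>n n'. N \<le> n \<longrightarrow> N \<le> n' \<longrightarrow> vdist S (g n) (g n') < e"
    proof (intro exI allI impI)
      fix i j assume "max N1 N2 \<le> i" "max N1 N2 \<le> j"
      then show "vdist S (g i) (g j) < e"
        using *[of i j] *[of j i] metric.commute[of "g i" "g j"] by (cases "i \<le> j") auto
    qed
  qed
  then obtain h where h: "limitin metric.mtopology g h sequentially"
    using complete unfolding metric.mcomplete_def by blast
  then have hS: "h \<in> vecs S" and conv: "(\<lambda>n. vdist S (g n) h) \<longlonglongrightarrow> 0"
    by (auto simp: metric.limitin_metric_dist_null)
  have "h k = f k" for k
  proof -
    obtain N :: nat where N: "bracket k \<le> real N" using real_arch_simple by blast
    have "g n k = f k" if "N \<le> n" for n using g(1)[of n] that N by (auto simp: E_def B_def)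
    then have "(\<lambda>n. g n k) \<longlonglongrightarrow> f k"
      by (intro tendsto_eventually) (auto simp: eventually_sequentially)
    with evaluation_limit[OF gS h] show ?thesis by (rule LIMSEQ_unique)
  qed
  then have hf: "h = f" by blast
  then show "f \<in> vecs S" using hS by simp
  have "vnorm S h \<le> vdist S (g n) h + sqrt (R\<^sup>2 + inverse (real (Suc n)))" for n
  proof -
    have "vnorm S h = vnorm S (\<lambda>k. (h k - g n k) + g n k)" by simp
    also have "\<dots> \<le> vnorm S (\<lambda>k. h k - g n k) + vnorm S (g n)"
      by (rule norm_plus[OF minus_closed[OF hS gS] gS])
    also have "vnorm S (\<lambda>k. h k - g n k) = vdist S (g n) h"
      unfolding dist_eq[OF hS gS, symmetric] by (rule metric.commute)
    also have "vnorm S (g n) \<le> sqrt (R\<^sup>2 + inverse (real (Suc n)))"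
      using g(2)[of n] d_R[of n] by (intro real_le_rsqrt) linarith
    finally show ?thesis by simp
  qed
  moreover have "(\<lambda>n. vdist S (g n) h + sqrt (R\<^sup>2 + inverse (real (Suc n)))) \<longlonglongrightarrow> 0 + sqrt (R\<^sup>2 + 0)"
    by (intro tendsto_intros conv LIMSEQ_inverse_real_of_nat)
  ultimately have "vnorm S h \<le> 0 + sqrt (R\<^sup>2 + 0)"
    by (intro LIMSEQ_le_const[of _ _ "vnorm S h"]) auto
  then show "vnorm S f \<le> R" using R0 hf by simp
qed

lemma weighted_composition_bounded_S:
  assumes "\<And>x. cmod (m x) \<le> 1" and "inj_on \<sigma> {x. m x \<noteq> 0}" and "1 \<le> R"
    and "\<And>x. m x \<noteq> 0 \<Longrightarrow> bracket x \<le> R * bracket (\<sigma> x) \<and> bracket (\<sigma> x) \<le> R * bracket x"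
  shows "bounded_linear_map S S (\<lambda>u x. m x * u (\<sigma> x))"
  using pair weighted_composition_bounded[OF assms] unfolding interpolation_space_pair_def by blast

lemma restricted_bounded:
  "\<exists>n::nat. \<forall>u\<in>vecs S. restricted A u \<in> vecs S \<and> vnorm S (restricted A u) \<le> real n * vnorm S u"
proof -
  let ?m = "\<lambda>k. if k \<in> A then 1 else 0 :: complex"
  have "bounded_linear_map S S (\<lambda>u x. ?m x * u (id x))"
    by (rule weighted_composition_bounded_S[of _ _ 1]) auto
  moreover have "(\<lambda>u x. ?m x * u (id x)) = restricted A" by (auto simp: restricted_def fun_eq_iff)
  ultimately have b: "bounded_linear_map S S (restricted A)" by simp
  then obtain C where C: "\<And>u. u \<in> vecs S \<Longrightarrow> vnorm S (restricted A u) \<le> C * vnorm S u"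
    by (auto simp: bounded_linear_map_def)
  obtain n :: nat where n: "C \<le> real n" using real_arch_simple by blast
  have "vnorm S (restricted A u) \<le> real n * vnorm S u" if "u \<in> vecs S" for u
    using C[OF that] mult_right_mono[OF n norm_nonneg[OF that]] by linarith
  then show ?thesis using b by (auto simp: bounded_linear_map_def linear_map_def)
qed

lemma restricted_mem: "u \<in> vecs S \<Longrightarrow> restricted A u \<in> vecs S"
  using restricted_bounded[of A] by blast

text \<open>The sets \<open>A\<close> for which restriction has norm at most \<open>n\<close> form a closed family by
  \<open>ball_pointwise_closed\<close>.  By category one \<open>n\<close> serves for a cylinder, and an arbitrary set differs
  from a member of the cylinder only inside a fixed finite set.\<close>

lemma restricted_uniformly_bounded:
  obtains C where "0 \<le> C" and "\<And>A u. u \<in> vecs S \<Longrightarrow> vnorm S (restricted A u) \<le> C * vnorm S u"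
proof -
  define K where "K n = {A. \<forall>u\<in>vecs S. vnorm S (restricted A u) \<le> real n * vnorm S u}" for n
  have "\<exists>n F A. finite F \<and> (\<forall>B. B \<inter> F = A \<inter> F \<longrightarrow> B \<in> K n)"
  proof (rule cylinder_category)
    show "\<exists>n. A \<in> K n" for A using restricted_bounded[of A] by (auto simp: K_def)
    fix n A assume approx: "\<And>F. finite F \<Longrightarrow> \<exists>A'\<in>K n. A' \<inter> F = A \<inter> F"
    have "vnorm S (restricted A u) \<le> real n * vnorm S u" if u: "u \<in> vecs S" for u
    proof (rule ball_pointwise_closed(2))
      fix F :: "(int ^ 'n) set" assume "finite F"
      then obtain A' where A': "A' \<in> K n" "A' \<inter> F = A \<inter> F" using approx by blast
      show "\<exists>g\<in>vecs S. vnorm S g \<le> real n * vnorm S u \<and> (\<forall>k\<in>F. g k = restricted A u k)"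
      proof (intro bexI conjI ballI)
        show "restricted A' u \<in> vecs S" by (rule restricted_mem[OF u])
        show "vnorm S (restricted A' u) \<le> real n * vnorm S u" using A'(1) u by (simp add: K_def)
        show "restricted A' u k = restricted A u k" if "k \<in> F" for k
          using A'(2) that by (auto simp: restricted_def)
      qed
    qed
    then show "A \<in> K n" by (simp add: K_def)
  qed
  then obtain n F A0 where F: "finite F" and cyl: "\<And>B. B \<inter> F = A0 \<inter> F \<Longrightarrow> B \<in> K n" by blast
  define \<sigma> where "\<sigma> = A0 \<inter> F"
  have "\<exists>c. B \<in> K c" for B using restricted_bounded[of B] by (auto simp: K_def)
  then obtain c where c: "\<And>B. B \<in> K (c B)" by metis
  define M where "M = Max (c ` Pow F)"
  have M: "B \<in> K M" if "B \<subseteq> F" for B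
  proof -
    have "c B \<le> M" unfolding M_def using F that by (intro Max_ge) auto
    then have "real (c B) * vnorm S u \<le> real M * vnorm S u" if "u \<in> vecs S" for u
      using norm_nonneg[OF that] by (intro mult_right_mono) auto
    then show ?thesis using c[of B] by (fastforce simp: K_def)
  qed
  have "vnorm S (restricted A u) \<le> (real n + 2 * real M) * vnorm S u" if u: "u \<in> vecs S" for A u
  proof -
    let ?A = "(A - F) \<union> \<sigma>"
    have "?A \<in> K n" by (intro cyl) (auto simp: \<sigma>_def)
    moreover have "A \<inter> F \<in> K M" "\<sigma> \<in> K M" by (auto intro: M simp: \<sigma>_def)
    ultimately have le: "vnorm S (restricted ?A u) \<le> real n * vnorm S u"
      "vnorm S (restricted (A \<inter> F) u) \<le> real M * vnorm S u"
      "vnorm S (restricted \<sigma> u) \<le> real M * vnorm S u"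
      using u by (auto simp: K_def)
    have "restricted A u = (\<lambda>k. (restricted ?A u k + restricted (A \<inter> F) u k) + (-1) * restricted \<sigma> u k)"
      by (auto simp: restricted_def fun_eq_iff \<sigma>_def)
    then have "vnorm S (restricted A u) = vnorm S (\<lambda>k. (restricted ?A u k + restricted (A \<inter> F) u k) + (-1) * restricted \<sigma> u k)"
      by simp
    also have "\<dots> \<le> vnorm S (\<lambda>k. restricted ?A u k + restricted (A \<inter> F) u k) + vnorm S (\<lambda>k. (-1) * restricted \<sigma> u k)"
      by (intro norm_plus plus_closed times_closed restricted_mem u)
    also have "vnorm S (\<lambda>k. (-1) * restricted \<sigma> u k) = vnorm S (restricted \<sigma> u)"
      by (subst norm_times[OF restricted_mem[OF u]]) simp
    also have "vnorm S (\<lambda>k. restricted ?A u k + restricted (A \<inter> F) u k) \<le> vnorm S (restricted ?A u) + vnorm S (restricted (A \<inter> F) u)"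
      by (intro norm_plus restricted_mem u)
    finally show ?thesis using le by (simp add: algebra_simps)
  qed
  then show ?thesis using that[of "real n + 2 * real M"] by simp
qed

text \<open>Reversing the sign on a set \<open>A\<close> is the identity minus twice the restriction to \<open>A\<close>.\<close>

lemma sign_multiplier_bounded:
  obtains D where "1 \<le> D"
    and "\<And>\<epsilon> u. u \<in> vecs S \<Longrightarrow> (\<And>k. \<epsilon> k = 1 \<or> \<epsilon> k = -1) \<Longrightarrow> vnorm S (\<lambda>k. \<epsilon> k * u k) \<le> D * vnorm S u"
proof -
  obtain C where C: "0 \<le> C" "\<And>A u. u \<in> vecs S \<Longrightarrow> vnorm S (restricted A u) \<le> C * vnorm S u"
    using restricted_uniformly_bounded by blast
  have "vnorm S (\<lambda>k. \<epsilon> k * u k) \<le> (1 + 2 * C) * vnorm S u"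
    if u: "u \<in> vecs S" and \<epsilon>: "\<And>k. \<epsilon> k = 1 \<or> \<epsilon> k = -1" for \<epsilon> u
  proof -
    let ?v = "restricted {k. \<epsilon> k = -1} u"
    have v: "?v \<in> vecs S" by (rule restricted_mem[OF u])
    have "(\<lambda>k. \<epsilon> k * u k) = (\<lambda>k. u k + (-2) * ?v k)"
    proof
      fix k show "\<epsilon> k * u k = u k + (-2) * ?v k"
        using \<epsilon>[of k] by (auto simp: restricted_def)
    qed
    then have "vnorm S (\<lambda>k. \<epsilon> k * u k) = vnorm S (\<lambda>k. u k + (-2) * ?v k)" by simp
    also have "\<dots> \<le> vnorm S u + vnorm S (\<lambda>k. (-2) * ?v k)"
      by (rule norm_plus[OF u times_closed[OF v]])
    also have "vnorm S (\<lambda>k. (-2) * ?v k) = 2 * vnorm S ?v"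
      by (subst norm_times[OF v]) simp
    finally show ?thesis using C(2)[OF u, of "{k. \<epsilon> k = -1}"] by (simp add: algebra_simps)
  qed
  then show ?thesis using that[of "1 + 2 * C"] C(1) by simp
qed

text \<open>For two vectors the squared norms of sum and difference average to the sum of the squared norms,
  so one of the two signs does not increase, and one does not decrease, the total.  The signs are
  chosen one point at a time.\<close>

lemma sign_choice:
  assumes "finite F"
  shows "\<exists>\<epsilon>. (\<forall>k. \<epsilon> k = 1 \<or> \<epsilon> k = -1) \<and>
      (vnorm S (restricted F (\<lambda>k. \<epsilon> k * u k)))\<^sup>2 \<le> (\<Sum>k\<in>F. (vnorm S (delta k) * cmod (u k))\<^sup>2)" (is "?L F")
    and "\<exists>\<epsilon>. (\<forall>k. \<epsilon> k = 1 \<or> \<epsilon> k = -1) \<and>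
      (\<Sum>k\<in>F. (vnorm S (delta k) * cmod (u k))\<^sup>2) \<le> (vnorm S (restricted F (\<lambda>k. \<epsilon> k * u k)))\<^sup>2" (is "?U F")
proof -
  have "?L F \<and> ?U F" using assms
  proof (induction F)
    case empty
    have "vnorm S (\<lambda>k. 0) = 0" using norm_zero by (simp add: zero_eq)
    then show ?case by (auto simp: restricted_def intro!: exI[of _ "\<lambda>k. 1"])
  next
    case (insert i F)
    let ?s = "\<lambda>F. \<Sum>k\<in>F. (vnorm S (delta k) * cmod (u k))\<^sup>2"
    define y where "y = (\<lambda>k. u i * delta i k)"
    have y: "y \<in> vecs S" unfolding y_def by (rule times_closed[OF delta_mem])
    have ny: "(vnorm S y)\<^sup>2 = (vnorm S (delta i) * cmod (u i))\<^sup>2"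
      unfolding y_def by (subst norm_times[OF delta_mem]) (simp add: mult.commute)
    have two: "\<exists>\<epsilon>1 \<epsilon>2. (\<forall>k. \<epsilon>1 k = 1 \<or> \<epsilon>1 k = -1) \<and> (\<forall>k. \<epsilon>2 k = 1 \<or> \<epsilon>2 k = -1) \<and>
        (vnorm S (restricted (insert i F) (\<lambda>k. \<epsilon>1 k * u k)))\<^sup>2 +
        (vnorm S (restricted (insert i F) (\<lambda>k. \<epsilon>2 k * u k)))\<^sup>2
        = 2 * ((vnorm S (restricted F (\<lambda>k. \<epsilon> k * u k)))\<^sup>2 + (vnorm S (delta i) * cmod (u i))\<^sup>2)"
      if \<epsilon>: "\<forall>k. \<epsilon> k = 1 \<or> \<epsilon> k = -1" for \<epsilon> :: "int ^ 'n \<Rightarrow> complex"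
    proof -
      let ?v = "restricted F (\<lambda>k. \<epsilon> k * u k)"
      have v: "?v \<in> vecs S"
        by (rule finite_support_mem) (rule finite_subset[OF _ insert.hyps(1)], auto simp: restricted_def)
      have "restricted (insert i F) (\<lambda>k. (\<epsilon>(i := 1)) k * u k) = (\<lambda>k. ?v k + y k)"
        "restricted (insert i F) (\<lambda>k. (\<epsilon>(i := -1)) k * u k) = (\<lambda>k. ?v k - y k)"
        using insert.hyps(2) by (auto simp: restricted_def y_def delta_def fun_eq_iff)
      then show ?thesis
        using norm_parallelogram[OF v y] \<epsilon> ny
        by (intro exI[of _ "\<epsilon>(i := 1)"] exI[of _ "\<epsilon>(i := -1)"]) simp
    qed
    have sum: "?s (insert i F) = ?s F + (vnorm S (delta i) * cmod (u i))\<^sup>2"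
      using insert.hyps by simp
    have pick: "p \<le> t \<or> q \<le> t" if "p + q = 2 * (x + z)" "x + z \<le> t" for p q t x z :: real
      using that by argo
    have pick': "t \<le> p \<or> t \<le> q" if "p + q = 2 * (x + z)" "t \<le> x + z" for p q t x z :: real
      using that by argo
    have "?L (insert i F)"
    proof -
      obtain \<epsilon> where "\<forall>k. \<epsilon> k = 1 \<or> \<epsilon> k = -1"
        "(vnorm S (restricted F (\<lambda>k. \<epsilon> k * u k)))\<^sup>2 \<le> ?s F" using insert.IH by blast
      from two[OF this(1)] this(2) show ?thesis
        unfolding sum using pick add_right_mono by meson
    qed
    moreover have "?U (insert i F)"
    proof -
      obtain \<epsilon> where "\<forall>k. \<epsilon> k = 1 \<or> \<epsilon> k = -1"
        "?s F \<le> (vnorm S (restricted F (\<lambda>k. \<epsilon> k * u k)))\<^sup>2" using insert.IH by blast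
      from two[OF this(1)] this(2) show ?thesis
        unfolding sum using pick' add_right_mono by meson
    qed
    ultimately show ?case by blast
  qed
  then show "?L F" "?U F" by blast+
qed

text \<open>For finitely supported functions the signs of \<open>sign_choice\<close> can be removed at the cost of the
  uniform sign bound.  The step to arbitrary functions uses the uniform bound for restrictions in
  one direction and pointwise closedness of balls in the other.\<close>

lemma norm_equivalent_weighted:
  obtains D where "0 < D"
    and "vecs S = {u. finite_energy (\<lambda>k. vnorm S (delta k)) u}"
    and "\<And>u. u \<in> vecs S \<Longrightarrow> vnorm S u \<le> D * sqrt (energy (\<lambda>k. vnorm S (delta k)) u)"
    and "\<And>u. u \<in> vecs S \<Longrightarrow> sqrt (energy (\<lambda>k. vnorm S (delta k)) u) \<le> D * vnorm S u"
proof -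
  let ?w = "\<lambda>k. vnorm S (delta k)"
  obtain C where C: "0 \<le> C" "\<And>A u. u \<in> vecs S \<Longrightarrow> vnorm S (restricted A u) \<le> C * vnorm S u"
    using restricted_uniformly_bounded by blast
  obtain D where D: "1 \<le> D"
    "\<And>\<epsilon> u. u \<in> vecs S \<Longrightarrow> (\<And>k. \<epsilon> k = 1 \<or> \<epsilon> k = -1) \<Longrightarrow> vnorm S (\<lambda>k. \<epsilon> k * u k) \<le> D * vnorm S u"
    using sign_multiplier_bounded by blast
  have fin: "restricted F u \<in> vecs S" if "finite F" for F u
    by (rule finite_support_mem) (rule finite_subset[OF _ that], auto simp: restricted_def)
  have upper: "vnorm S (restricted F u) \<le> D * sqrt (\<Sum>k\<in>F. (?w k * cmod (u k))\<^sup>2)" if F: "finite F" for F u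
  proof -
    obtain \<epsilon> where \<epsilon>: "\<And>k. \<epsilon> k = 1 \<or> \<epsilon> k = -1"
      and le: "(vnorm S (restricted F (\<lambda>k. \<epsilon> k * u k)))\<^sup>2 \<le> (\<Sum>k\<in>F. (?w k * cmod (u k))\<^sup>2)"
      using sign_choice(1)[OF F, of u] by blast
    have undo: "(\<lambda>k. \<epsilon> k * restricted F (\<lambda>k. \<epsilon> k * u k) k) = restricted F u"
    proof
      show "\<epsilon> k * restricted F (\<lambda>k. \<epsilon> k * u k) k = restricted F u k" for k
        using \<epsilon>[of k] by (elim disjE) (simp_all add: restricted_def)
    qed
    have "vnorm S (restricted F u) \<le> D * vnorm S (restricted F (\<lambda>k. \<epsilon> k * u k))"
      using D(2)[OF fin[OF F, of "\<lambda>k. \<epsilon> k * u k"], of \<epsilon>, OF \<epsilon>] unfolding undo .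
    also have "\<dots> \<le> D * sqrt (\<Sum>k\<in>F. (?w k * cmod (u k))\<^sup>2)"
      using D(1) le by (intro mult_left_mono real_le_rsqrt) auto
    finally show ?thesis .
  qed
  have lower: "(\<Sum>k\<in>F. (?w k * cmod (u k))\<^sup>2) \<le> (D * C * vnorm S u)\<^sup>2"
    if F: "finite F" and u: "u \<in> vecs S" for F u
  proof -
    obtain \<epsilon> where \<epsilon>: "\<And>k. \<epsilon> k = 1 \<or> \<epsilon> k = -1"
      and le: "(\<Sum>k\<in>F. (?w k * cmod (u k))\<^sup>2) \<le> (vnorm S (restricted F (\<lambda>k. \<epsilon> k * u k)))\<^sup>2"
      using sign_choice(2)[OF F, of u] by blast
    have eq: "restricted F (\<lambda>k. \<epsilon> k * u k) = (\<lambda>k. \<epsilon> k * restricted F u k)" by (auto simp: restricted_def)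
    have "vnorm S (restricted F (\<lambda>k. \<epsilon> k * u k)) \<le> D * vnorm S (restricted F u)"
      unfolding eq by (rule D(2)[OF fin[OF F] \<epsilon>])
    also have "\<dots> \<le> D * (C * vnorm S u)" using D(1) by (intro mult_left_mono C u) auto
    finally have "(vnorm S (restricted F (\<lambda>k. \<epsilon> k * u k)))\<^sup>2 \<le> (D * C * vnorm S u)\<^sup>2"
      by (intro power_mono norm_nonneg fin F) (simp add: mult.assoc)
    then show ?thesis using le by linarith
  qed
  have into: "finite_energy ?w u" "sqrt (energy ?w u) \<le> D * C * vnorm S u" if u: "u \<in> vecs S" for u
  proof -
    show "finite_energy ?w u" by (rule finite_energyI(1)[OF lower[OF _ u]])
    have "energy ?w u \<le> (D * C * vnorm S u)\<^sup>2" by (rule finite_energyI(2)[OF lower[OF _ u]])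
    then show "sqrt (energy ?w u) \<le> D * C * vnorm S u"
      using D(1) C(1) norm_nonneg[OF u] by (intro real_le_lsqrt) auto
  qed
  have realized: "u \<in> vecs S \<and> vnorm S u \<le> D * sqrt (energy ?w u)" if u: "finite_energy ?w u" for u
  proof -
    have approx: "\<exists>g\<in>vecs S. vnorm S g \<le> D * sqrt (energy ?w u) \<and> (\<forall>k\<in>F. g k = u k)" if F: "finite F" for F
    proof (intro bexI conjI ballI)
      show "restricted F u \<in> vecs S" by (rule fin[OF F])
      have "vnorm S (restricted F u) \<le> D * sqrt (\<Sum>k\<in>F. (?w k * cmod (u k))\<^sup>2)" by (rule upper[OF F])
      also have "\<dots> \<le> D * sqrt (energy ?w u)"
        using D(1) by (intro mult_left_mono real_sqrt_le_mono sum_le_energy u F) auto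
      finally show "vnorm S (restricted F u) \<le> D * sqrt (energy ?w u)" .
      show "restricted F u k = u k" if "k \<in> F" for k using that by (simp add: restricted_def)
    qed
    show ?thesis using ball_pointwise_closed[OF approx] by (rule conjI)
  qed
  show ?thesis
  proof (rule that[of "max D (D * C)"])
    show "0 < max D (D * C)" using D(1) by (simp add: less_max_iff_disj)
    show "vecs S = {u. finite_energy ?w u}" using into(1) realized by blast
    fix u assume u: "u \<in> vecs S"
    have "vnorm S u \<le> D * sqrt (energy ?w u)" using realized into(1)[OF u] by blast
    also have "\<dots> \<le> max D (D * C) * sqrt (energy ?w u)"
      by (intro mult_right_mono) (auto simp: energy_nonneg)
    finally show "vnorm S u \<le> max D (D * C) * sqrt (energy ?w u)" .
    have "sqrt (energy ?w u) \<le> D * C * vnorm S u" by (rule into(2)[OF u])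
    also have "\<dots> \<le> max D (D * C) * vnorm S u" by (intro mult_right_mono norm_nonneg u) auto
    finally show "sqrt (energy ?w u) \<le> max D (D * C) * vnorm S u" .
  qed
qed

text \<open>If the claim failed, there would be disjoint pairs of comparable points with unbounded ratio of
  norms; pairs that meet a given finite set are finite in number, hence cannot be
  responsible for the failure.  The operator that moves all the point masses of these pairs at once
  is bounded on the Sobolev spaces but not on \<open>S\<close>.\<close>

lemma delta_norm_comparable:
  assumes R: "1 \<le> R"
  obtains C where "1 \<le> C"
    and "\<And>k l. bracket k \<le> R * bracket l \<Longrightarrow> bracket l \<le> R * bracket k \<Longrightarrow>
      vnorm S (delta l) \<le> C * vnorm S (delta k)"
proof -
  let ?w = "\<lambda>k. vnorm S (delta k)"
  define comparable where "comparable k l \<longleftrightarrow> bracket k \<le> R * bracket l \<and> bracket l \<le> R * bracket k"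
    for k l :: "int ^ 'n"
  have wpos: "0 < ?w k" for k
    using admissible_delta_norm unfolding admissible_weight_def by blast
  have "\<exists>n::nat. \<forall>k l. comparable k l \<longrightarrow> ?w l \<le> real n * ?w k"
  proof (rule ccontr)
    assume "\<not> ?thesis"
    then have bad: "\<exists>k l. comparable k l \<and> real n * ?w k < ?w l" for n by (meson not_le)
    define P where "P n p \<longleftrightarrow> comparable (fst p) (snd p) \<and> real n * ?w (fst p) < ?w (snd p)"
      for n :: nat and p
    define supp where "supp p = {fst p, snd p}" for p :: "(int ^ 'n) \<times> (int ^ 'n)"
    have hump: "\<exists>p. P n p \<and> finite (supp p) \<and> supp p \<inter> F = {}" if F: "finite F" for n F
    proof -
      define Q where "Q = (\<Union>k\<in>F. {k} \<times> {l. bracket l \<le> R * bracket k}) \<union>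
        (\<Union>l\<in>F. {k. bracket k \<le> R * bracket l} \<times> {l})"
      have "finite Q" unfolding Q_def using F by (auto intro!: finite_bracket_ball)
      then have "finite ((\<lambda>(k, l). ?w l / ?w k) ` Q)" by (rule finite_imageI)
      then have "bdd_above ((\<lambda>(k, l). ?w l / ?w k) ` Q)" by (rule bdd_above_finite)
      then obtain c where c0: "\<forall>x\<in>(\<lambda>(k, l). ?w l / ?w k) ` Q. x \<le> c" by (auto simp only: bdd_above_def)
      have c: "?w l / ?w k \<le> c" if "(k, l) \<in> Q" for k l
        using bspec[OF c0 imageI[OF that]] by simp
      obtain N :: nat where N: "max (real n) c \<le> real N" using real_arch_simple by blast
      obtain k l where kl: "comparable k l" "real N * ?w k < ?w l" using bad by blast
      have "(k, l) \<notin> Q"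
      proof
        assume "(k, l) \<in> Q"
        then have "?w l \<le> c * ?w k" using c[of k l] wpos[of k] by (simp add: field_simps)
        also have "\<dots> \<le> real N * ?w k" using N wpos[of k] by (intro mult_right_mono) auto
        finally show False using kl by simp
      qed
      then have "k \<notin> F" "l \<notin> F" using kl(1) by (auto simp: Q_def comparable_def)
      moreover have "real n * ?w k \<le> real N * ?w k" using N wpos[of k] by (intro mult_right_mono) auto
      ultimately show ?thesis
        using kl by (intro exI[of _ "(k, l)"]) (auto simp: P_def supp_def)
    qed
    obtain p where p: "\<And>n. P n (p n)" "\<And>m n. m \<noteq> n \<Longrightarrow> supp (p m) \<inter> supp (p n) = {}"
      using disjoint_selection[of P supp, OF hump] by blast
    define k l where "k n = fst (p n)" and "l n = snd (p n)" for n
    have comp: "comparable (k n) (l n)" and big: "real n * ?w (k n) < ?w (l n)" for n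
      using p(1)[of n] by (auto simp: P_def k_def l_def)
    have inj: "inj k" "inj l"
      using p(2) unfolding inj_on_def supp_def k_def l_def by blast+
    define m :: "int ^ 'n \<Rightarrow> complex" where "m y = (if y \<in> range l then 1 else 0)" for y
    define \<sigma> where "\<sigma> y = k (inv l y)" for y
    have \<sigma>: "\<sigma> (l n) = k n" for n using inj(2) by (simp add: \<sigma>_def)
    have "bounded_linear_map S S (\<lambda>u y. m y * u (\<sigma> y))"
    proof (rule weighted_composition_bounded_S[OF _ _ R])
      show "cmod (m y) \<le> 1" for y by (simp add: m_def)
      show "inj_on \<sigma> {y. m y \<noteq> 0}"
        by (auto simp: inj_on_def[of \<sigma>] m_def \<sigma> inj_eq[OF inj(1)] split: if_splits)
      show "bracket y \<le> R * bracket (\<sigma> y) \<and> bracket (\<sigma> y) \<le> R * bracket y" if "m y \<noteq> 0" for y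
        using that comp by (auto simp: m_def \<sigma> comparable_def split: if_splits)
    qed
    then obtain C where C: "\<And>u. u \<in> vecs S \<Longrightarrow> vnorm S (\<lambda>y. m y * u (\<sigma> y)) \<le> C * vnorm S u"
      by (auto simp: bounded_linear_map_def)
    have shift: "(\<lambda>y. m y * delta (k n) (\<sigma> y)) = delta (l n)" for n
    proof
      fix y show "m y * delta (k n) (\<sigma> y) = delta (l n) y"
      proof (cases "y \<in> range l")
        case True
        then obtain j where "y = l j" by blast
        then show ?thesis using inj by (auto simp: m_def \<sigma> delta_def inj_eq)
      qed (auto simp: m_def delta_def)
    qed
    obtain n :: nat where n: "C \<le> real n" using real_arch_simple by blast
    have "?w (l n) \<le> C * ?w (k n)" using C[OF delta_mem[of "k n"]] by (simp only: shift)
    also have "\<dots> \<le> real n * ?w (k n)" using n wpos[of "k n"] by (intro mult_right_mono) auto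
    finally show False using big[of n] by simp
  qed
  then obtain n :: nat where n: "\<And>k l. comparable k l \<Longrightarrow> ?w l \<le> real n * ?w k" by blast
  have "?w l \<le> (real n + 1) * ?w k" if "comparable k l" for k l
    using n[OF that] wpos[of k] by (simp add: algebra_simps)
  then show ?thesis using that[of "real n + 1"] by (simp add: comparable_def)
qed

text \<open>The function \<open>\<phi>\<close> samples the norms of the point masses along one coordinate axis.  The factor \<open>8\<close>
  is what the comparison needs: a point on the axis has size within a factor \<open>2\<close> of its argument,
  and the argument itself may double.\<close>

lemma equal_sobolev_RO: "\<exists>\<phi>\<in>RO. equal_up_to_norm_equivalence S (sobolev_RO \<phi>)"
proof -
  let ?w = "\<lambda>k. vnorm S (delta k)"
  have wpos: "0 < ?w k" for k
    using admissible_delta_norm unfolding admissible_weight_def by blast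
  obtain C where C: "1 \<le> C"
    and comparable: "\<And>k l. bracket k \<le> 8 * bracket l \<Longrightarrow> bracket l \<le> 8 * bracket k \<Longrightarrow> ?w l \<le> C * ?w k"
    using delta_norm_comparable[of 8] by auto
  \<comment> \<open>The direction of the axis is immaterial; \<open>undefined\<close> names one of the coordinates.\<close>
  define p where "p t = (axis undefined \<lfloor>t\<rfloor> :: int ^ 'n)" for t :: real
  have bracket_p: "t \<le> 2 * bracket (p t)" "bracket (p t) \<le> 2 * t" if t: "1 \<le> t" for t
  proof -
    have "(\<Sum>i\<in>UNIV. (real_of_int (p t $ i))\<^sup>2) = (real_of_int \<lfloor>t\<rfloor>)\<^sup>2"
      by (simp add: p_def axis_def if_distrib[of real_of_int] if_distrib[of "\<lambda>x. x\<^sup>2"] cong: if_cong)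
    then have b: "bracket (p t) = sqrt (1 + (real_of_int \<lfloor>t\<rfloor>)\<^sup>2)"
      by (simp add: bracket_def lattice_norm_def)
    have fl: "1 \<le> real_of_int \<lfloor>t\<rfloor>" "real_of_int \<lfloor>t\<rfloor> \<le> t" "t < real_of_int \<lfloor>t\<rfloor> + 1"
      using t by (auto simp: le_floor_iff)
    have "real_of_int \<lfloor>t\<rfloor> \<le> bracket (p t)" unfolding b by (rule real_le_rsqrt) simp
    then show "t \<le> 2 * bracket (p t)" using fl by linarith
    have "(real_of_int \<lfloor>t\<rfloor>)\<^sup>2 \<le> t\<^sup>2" "1 \<le> t\<^sup>2" using fl t by (auto intro: power_mono)
    moreover have "(2 * t)\<^sup>2 = 4 * t\<^sup>2" by (simp add: power_mult_distrib)
    ultimately have "1 + (real_of_int \<lfloor>t\<rfloor>)\<^sup>2 \<le> (2 * t)\<^sup>2" by linarith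
    then show "bracket (p t) \<le> 2 * t" unfolding b using t by (intro real_le_lsqrt) auto
  qed
  define \<phi> where "\<phi> t = ?w (p t)" for t
  have \<phi>pos: "0 < \<phi> t" for t by (simp add: \<phi>_def wpos)
  have "\<phi> \<in> borel_measurable borel"
  proof -
    have "(\<lambda>z. ?w (axis undefined z :: int ^ 'n)) \<in> measurable (count_space UNIV) (borel :: real measure)"
      by simp
    from measurable_compose[OF measurable_real_floor this] show ?thesis
      unfolding \<phi>_def p_def .
  qed
  then have meas: "\<phi> \<in> borel_measurable (restrict_space borel {1..})"
    by (rule measurable_restrict_space1)
  have ratio: "inverse C \<le> \<phi> (l * t) / \<phi> t \<and> \<phi> (l * t) / \<phi> t \<le> C" if t: "1 \<le> t" and l: "l \<in> {1..2}" for t l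
  proof -
    have lt: "t \<le> l * t" "l * t \<le> 2 * t" using t l by auto
    then have 1: "1 \<le> l * t" using t by linarith
    have cmp: "bracket (p (l * t)) \<le> 8 * bracket (p t)" "bracket (p t) \<le> 8 * bracket (p (l * t))"
      using bracket_p[OF t] bracket_p[OF 1] lt by linarith+
    have "\<phi> (l * t) \<le> C * \<phi> t" "\<phi> t \<le> C * \<phi> (l * t)"
      unfolding \<phi>_def using comparable cmp by blast+
    then show ?thesis using \<phi>pos[of t] C by (simp add: field_simps)
  qed
  have RO: "\<phi> \<in> RO"
    unfolding RO_def mem_Collect_eq
  proof (intro conjI allI impI meas \<phi>pos exI ballI)
    show "(1 :: real) < 2" by simp
    show "1 \<le> C" by (fact C)
  qed (use ratio in blast)+
  have near: "?w k \<le> C * \<phi> (bracket k)" "\<phi> (bracket k) \<le> C * ?w k" for k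
  proof -
    have "bracket k \<le> 8 * bracket (p (bracket k))" "bracket (p (bracket k)) \<le> 8 * bracket k"
      using bracket_p[OF bracket_ge_1[of k]] bracket_pos[of k] bracket_pos[of "p (bracket k)"] by linarith+
    then show "?w k \<le> C * \<phi> (bracket k)" "\<phi> (bracket k) \<le> C * ?w k"
      unfolding \<phi>_def using comparable by blast+
  qed
  let ?\<phi> = "\<lambda>k :: int ^ 'n. \<phi> (bracket k)"
  have adm: "admissible_weight ?\<phi>"
  proof -
    obtain c s where c: "c > 0" "\<And>k. c * bracket k powr s \<le> ?w k"
      using admissible_delta_norm unfolding admissible_weight_def by blast
    have "(c / C) * bracket k powr s \<le> ?\<phi> k" for k
      using order_trans[OF c(2)[of k] near(1)[of k]] C by (simp add: field_simps)
    moreover have "c / C > 0" using c C by simp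
    ultimately show ?thesis unfolding admissible_weight_def using \<phi>pos by blast
  qed
  have dom1: "\<bar>?w k * cmod (u k)\<bar> \<le> C * \<bar>?\<phi> k * cmod (u k)\<bar>" for k u
    using mult_right_mono[OF near(1)[of k], of "cmod (u k)"] wpos[of k] \<phi>pos[of "bracket k"]
    by (simp add: abs_mult)
  have dom2: "\<bar>?\<phi> k * cmod (u k)\<bar> \<le> C * \<bar>?w k * cmod (u k)\<bar>" for k u
    using mult_right_mono[OF near(2)[of k], of "cmod (u k)"] wpos[of k] \<phi>pos[of "bracket k"]
    by (simp add: abs_mult)
  have C0: "0 \<le> C" using C by simp
  have le1: "finite_energy ?w u" "sqrt (energy ?w u) \<le> C * sqrt (energy ?\<phi> u)" if u: "finite_energy ?\<phi> u" for u
  proof -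
    show "finite_energy ?w u" by (rule energy_dominated(1)[OF u C0]) (rule dom1)
    have "energy ?w u \<le> C\<^sup>2 * energy ?\<phi> u" by (rule energy_dominated(2)[OF u C0]) (rule dom1)
    then have "sqrt (energy ?w u) \<le> sqrt (C\<^sup>2 * energy ?\<phi> u)" by (rule real_sqrt_le_mono)
    then show "sqrt (energy ?w u) \<le> C * sqrt (energy ?\<phi> u)" using C0 by (simp add: real_sqrt_mult)
  qed
  have le2: "finite_energy ?\<phi> u" "sqrt (energy ?\<phi> u) \<le> C * sqrt (energy ?w u)" if u: "finite_energy ?w u" for u
  proof -
    show "finite_energy ?\<phi> u" by (rule energy_dominated(1)[OF u C0]) (rule dom2)
    have "energy ?\<phi> u \<le> C\<^sup>2 * energy ?w u" by (rule energy_dominated(2)[OF u C0]) (rule dom2)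
    then have "sqrt (energy ?\<phi> u) \<le> sqrt (C\<^sup>2 * energy ?w u)" by (rule real_sqrt_le_mono)
    then show "sqrt (energy ?\<phi> u) \<le> C * sqrt (energy ?w u)" using C0 by (simp add: real_sqrt_mult)
  qed
  obtain D where D: "0 < D" and vecs: "vecs S = {u. finite_energy ?w u}"
    and norms: "\<And>u. u \<in> vecs S \<Longrightarrow> vnorm S u \<le> D * sqrt (energy ?w u)"
      "\<And>u. u \<in> vecs S \<Longrightarrow> sqrt (energy ?w u) \<le> D * vnorm S u"
    using norm_equivalent_weighted by blast
  have same: "vecs S = vecs (sobolev_RO \<phi>)"
    unfolding sobolev_RO_def vecs_weighted[OF adm] vecs using le1(1) le2(1) by blast
  have "linear_map S (sobolev_RO \<phi>) (\<lambda>u. u)"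
    unfolding linear_map_def
    by (auto simp: same[symmetric] add_eq scale_eq) (auto simp: sobolev_RO_def weighted_ops)
  moreover have "1 / (C * D) * vnorm (sobolev_RO \<phi>) u \<le> vnorm S u \<and> vnorm S u \<le> D * C * vnorm (sobolev_RO \<phi>) u"
    if u: "u \<in> vecs S" for u
  proof -
    have w: "finite_energy ?w u" "finite_energy ?\<phi> u" using u le2(1) by (auto simp: vecs)
    have "sqrt (energy ?\<phi> u) \<le> C * sqrt (energy ?w u)" by (rule le2(2)[OF w(1)])
    also have "\<dots> \<le> C * (D * vnorm S u)" using C0 by (intro mult_left_mono norms u)
    finally have 1: "sqrt (energy ?\<phi> u) \<le> C * D * vnorm S u" by (simp add: mult.assoc)
    have "vnorm S u \<le> D * sqrt (energy ?w u)" by (rule norms(1)[OF u])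
    also have "\<dots> \<le> D * (C * sqrt (energy ?\<phi> u))" using D by (intro mult_left_mono le1 w) auto
    finally show ?thesis
      using 1 C D by (simp add: sobolev_RO_def vnorm_weighted field_simps)
  qed
  moreover have "0 < 1 / (C * D)" "0 < D * C" using C D by auto
  ultimately have "equal_up_to_norm_equivalence S (sobolev_RO \<phi>)"
    unfolding equal_up_to_norm_equivalence_def using same by blast
  then show ?thesis using RO by blast
qed

end


section \<open>The characterization\<close>

theorem corollary2p1:
  fixes S :: "(int ^ 'n \<Rightarrow> complex) ip_space"
  assumes "complex_hilbert_space S"
  shows "interpolation_space_scale sobolev S \<longleftrightarrow>
         (\<exists>\<phi>\<in>RO. equal_up_to_norm_equivalence S (sobolev_RO \<phi>))"
proof
  assume "interpolation_space_scale sobolev S"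
  then obtain s0 s1 where "interpolation_space_pair (sobolev s0) (sobolev s1) S"
    by (auto simp: interpolation_space_scale_def)
  then interpret sobolev_interpolation S s0 s1
    using assms by (intro sobolev_interpolation.intro sobolev_interpolation_axioms.intro)
  show "\<exists>\<phi>\<in>RO. equal_up_to_norm_equivalence S (sobolev_RO \<phi>)" by (rule equal_sobolev_RO)
next
  assume "\<exists>\<phi>\<in>RO. equal_up_to_norm_equivalence S (sobolev_RO \<phi>)"
  then show "interpolation_space_scale sobolev S" using sobolev_RO_interpolation[OF assms] by blast
qed

end
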